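(* Let $k\ge0$ be an integer, $h\in C^{2k}(T)$ positive, and let $V_0,V_1$ be given. The terms $Q^{(2k)},\psi^{(2k)}$ of the stream function expansion (defined recursively in the context) have the form $$Q^{(2k)}=\frac{I_2}{I_3}a^{(2k)}+\sum_{\ell=0}^{k-1}Q^{(2\ell)}b^{(2k-2\ell)},\qquad \psi^{(2k)}=\frac{I_2}{I_3}\alpha^{(2k)}+\sum_{\ell=0}^kQ^{(2\ell)}\beta^{(2k-2\ell)},$$ where $$\alpha^{(2k)}(x,y)=\sum_{n=1}^{2k+3}\alpha_n^{(2k)}(x)\frac{y^n}{h(x)^n},\qquad \beta^{(2k)}(x,y)=\sum_{n=1}^{2k+3}\beta_n^{(2k)}(x)\frac{y^n}{h(x)^n},$$ and $$\alpha_n^{(2k)}\in\frac{I_3}{I_2}\,h\,\mathcal{V}_1\mathcal{H}_{2k},\qquad \beta_n^{(2k)}\in\mathcal{H}_{2k}.$$ Moreover, $a^{(2k)}=\frac1{2I_3}\int_0^1\frac{\alpha_3^{(2k)}(x)}{h(x)^3}\,dx$ and $b^{(2k)}=\frac1{2I_3}\int_0^1\frac{\beta_3^{(2k)}(x)}{h(x)^3}\,dx$.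
   Context: $T=[0,1]_p$ is the periodic unit interval; $\Omega=\{(x,y):0\le x\le1,\ 0<y<h(x)\}$ ($x$-periodic); $I_m=\int_0^1h(x)^{-m}\,dx$. **Expansion terms.** For a function $f$ on $\Omega$, a constant $g_0$ and a function $g_1(x)$, define $(\psi,Q)=G(f,g_0,g_1)$ as follows. With $\mathbb{V}f(x,y)=\int_0^yf(x,\eta)\,d\eta$, let $\psi_0=\mathbb{V}^4f$, $$Q=\frac1{2I_3}\int_0^1\frac{2\psi_0(x,h(x))}{h(x)^3}+\frac{-\psi_{0,y}(x,h(x))+g_0+g_1(x)}{h(x)^2}\,dx,$$ $$\psi(x,y)=\psi_0(x,y)+g_0h\tfrac yh+\left(3Q-3\psi_0(x,h)+\psi_{0,y}(x,h)h-2g_0h-g_1h\right)\tfrac{y^2}{h^2}+\left(-2Q+2\psi_0(x,h)-\psi_{0,y}(x,h)h+g_0h+g_1h\right)\tfrac{y^3}{h^3},$$ where $h=h(x)$, $g_1=g_1(x)$. (So $\psi_{yyyy}=f$; $\psi=0,\psi_y=g_0$ at $y=0$; $\psi=Q,\psi_y=g_1$ at $y=h(x)$; $\int_0^1\psi_{yyy}(x,0)\,dx=0$.) For $k=0,1,2,\dots$ set $(\psi^{(2k)},Q^{(2k)})=G(f^{(2k)},g_0^{(2k)},g_1^{(2k)})$, where $f^{(0)}=0$, $f^{(2)}=-2\psi^{(0)}_{xxyy}$, $f^{(2k)}=-2\psi^{(2k-2)}_{xxyy}-\psi^{(2k-4)}_{xxxx}$ for $k\ge2$; $g_0^{(0)}=V_0$,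 $g_0^{(2k)}=0$ for $k\ge1$; $g_1^{(2k)}(x)=V_1\binom{-1/2}{k}h'(x)^{2k}$. **Algebraic spaces.** $\mathcal{P}=\mathbb{Q}[h,h_x,h_{xx},\dots]$ is the algebra of polynomials over $\mathbb{Q}$ in $h$ and its derivatives, which are treated as independent formal symbols. The superdegree of a nonzero monomial $Ch^{i_0}h_x^{i_1}h_{xx}^{i_2}\cdots$ is $i_1+2i_2+3i_3+\cdots$; an element of $\mathcal P$ is homogeneous of superdegree $k$ if each of its terms has superdegree $k$. $\mathcal{H}=\mathbb{Q}[\{h_x,hh_{xx},h^2h_{xxx},\dots\}]\subset\mathcal{P}$ is the subalgebra generated by $\{h^{j-1}\partial_x^jh:j\ge1\}$, and $\mathcal{H}_k=\{0\}\cup\{\alpha\in\mathcal{H}:\alpha\text{ is homogeneous of superdegree }k\}$. $\mathcal{V}_1$ is the space of rational linear combinations of the symbols $V_0,V_1$, and $\mathcal{V}_1\mathcal{H}_{2k}$ is the tensor product of $\mathcal{V}_1$ and $\mathcal{H}_{2k}$ (elements $V_0p+V_1q$ with $p,q\in\mathcal{H}_{2k}$). Membership statements are formal: they say that the coefficient is given by a fixed formal polynomial expression (not depending on the particular function $h$ or values $V_0,V_1$; $\alpha_n^{(2k)}$ being $\frac{I_3}{I_2}h$ times an element of $\mathcal V_1\mathcal H_{2k}$), and the function $\alpha_n^{(2k)}(x)$ or $\beta_n^{(2k)}(x)$ is obtained by substituting the actual $h$, its derivatives, and $V_0,V_1$. *)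

theory Defs
  imports "HOL-Analysis.Analysis" "HOL-Library.Poly_Mapping"
begin

section \<open>The stream function expansion\<close>

text \<open>
  Functions on the periodic unit interval are 1-periodic functions on the real line, and the
  \<open>x\<close>-periodic domain is represented by its lift to the plane.
\<close>

definition C_periodic :: "nat \<Rightarrow> (real \<Rightarrow> real) \<Rightarrow> bool" where
  "C_periodic n h \<longleftrightarrow>
     (\<forall>x. h (x + 1) = h x) \<and>
     (\<forall>j<n. \<forall>x. (deriv ^^ j) h field_differentiable at x) \<and>
     continuous_on UNIV ((deriv ^^ n) h)"

definition Omega :: "(real \<Rightarrow> real) \<Rightarrow> (real \<times> real) set" where
  "Omega h = {(x, y). 0 < y \<and> y < h x}"

definition I_int :: "(real \<Rightarrow> real) \<Rightarrow> nat \<Rightarrow> real" where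
  "I_int h m = integral {0..1} (\<lambda>x. 1 / h x ^ m)"

definition Vop :: "(real \<Rightarrow> real \<Rightarrow> real) \<Rightarrow> real \<Rightarrow> real \<Rightarrow> real" where
  "Vop f x y = integral {0..y} (\<lambda>\<eta>. f x \<eta>)"

definition dx :: "(real \<Rightarrow> real \<Rightarrow> real) \<Rightarrow> real \<Rightarrow> real \<Rightarrow> real" where
  "dx f x y = deriv (\<lambda>t. f t y) x"

definition dy :: "(real \<Rightarrow> real \<Rightarrow> real) \<Rightarrow> real \<Rightarrow> real \<Rightarrow> real" where
  "dy f x y = deriv (\<lambda>t. f x t) y"

text \<open>
  The derivative \<open>\<psi>\<^sub>0\<^sub>,\<^sub>y(x, h(x))\<close> on the upper boundary is taken from inside the domain, so that the
  result on the domain does not depend on the values of \<open>f\<close> outside it (Isabelle's total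
  functions assign some value there).
\<close>

definition G :: "(real \<Rightarrow> real) \<Rightarrow> (real \<Rightarrow> real \<Rightarrow> real) \<Rightarrow> real \<Rightarrow> (real \<Rightarrow> real)
                  \<Rightarrow> (real \<Rightarrow> real \<Rightarrow> real) \<times> real" where
  "G h f g0 g1 =
    (let \<psi>0 = (Vop ^^ 4) f;
         top = (\<lambda>x. \<psi>0 x (h x));
         top_y = (\<lambda>x. vector_derivative (\<psi>0 x) (at_left (h x)));
         Q = 1 / (2 * I_int h 3) *
             integral {0..1} (\<lambda>x. 2 * top x / h x ^ 3 + (- top_y x + g0 + g1 x) / h x ^ 2);
         \<psi> = (\<lambda>x y. \<psi>0 x y + g0 * h x * (y / h x)
               + (3 * Q - 3 * top x + top_y x * h x - 2 * g0 * h x - g1 x * h x) * (y^2 / h x ^ 2)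
               + (- 2 * Q + 2 * top x - top_y x * h x + g0 * h x + g1 x * h x) * (y^3 / h x ^ 3))
     in (\<psi>, Q))"

definition g1_term :: "(real \<Rightarrow> real) \<Rightarrow> real \<Rightarrow> nat \<Rightarrow> real \<Rightarrow> real" where
  "g1_term h V1 k x = V1 * ((- 1 / 2) gchoose k) * deriv h x ^ (2 * k)"

text \<open>\<open>expansion h V0 V1 k\<close> is the pair \<open>(\<psi>\<^sup>(\<^sup>2\<^sup>k\<^sup>), Q\<^sup>(\<^sup>2\<^sup>k\<^sup>))\<close>.\<close>

fun expansion :: "(real \<Rightarrow> real) \<Rightarrow> real \<Rightarrow> real \<Rightarrow> nat \<Rightarrow> (real \<Rightarrow> real \<Rightarrow> real) \<times> real" where
  "expansion h V0 V1 0 = G h (\<lambda>x y. 0) V0 (g1_term h V1 0)"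
| "expansion h V0 V1 (Suc 0) =
     G h (\<lambda>x y. - 2 * dy (dy (dx (dx (fst (expansion h V0 V1 0))))) x y) 0 (g1_term h V1 1)"
| "expansion h V0 V1 (Suc (Suc k)) =
     G h (\<lambda>x y. - 2 * dy (dy (dx (dx (fst (expansion h V0 V1 (Suc k)))))) x y
                 - dx (dx (dx (dx (fst (expansion h V0 V1 k))))) x y)
       0 (g1_term h V1 (Suc (Suc k)))"

definition psi_term :: "(real \<Rightarrow> real) \<Rightarrow> real \<Rightarrow> real \<Rightarrow> nat \<Rightarrow> real \<Rightarrow> real \<Rightarrow> real" where
  "psi_term h V0 V1 k = fst (expansion h V0 V1 k)"

definition Q_term :: "(real \<Rightarrow> real) \<Rightarrow> real \<Rightarrow> real \<Rightarrow> nat \<Rightarrow> real" where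
  "Q_term h V0 V1 k = snd (expansion h V0 V1 k)"


section \<open>The algebraic spaces\<close>

text \<open>
  \<open>diff_poly\<close> is the polynomial ring over the rationals in indeterminates indexed by \<open>nat\<close>;
  the \<open>j\<close>-th indeterminate is the formal symbol for the \<open>j\<close>-th derivative of \<open>h\<close>.
\<close>

type_synonym diff_monom = "nat \<Rightarrow>\<^sub>0 nat"
type_synonym diff_poly = "diff_monom \<Rightarrow>\<^sub>0 rat"

definition hvar :: "nat \<Rightarrow> diff_poly" where
  "hvar j = Poly_Mapping.single (Poly_Mapping.single j 1) 1"

definition superdegree :: "diff_monom \<Rightarrow> nat" where
  "superdegree m = (\<Sum>j\<in>Poly_Mapping.keys m. j * Poly_Mapping.lookup m j)"

definition homogeneous :: "nat \<Rightarrow> diff_poly \<Rightarrow> bool" where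
  "homogeneous k p \<longleftrightarrow> (\<forall>m\<in>Poly_Mapping.keys p. superdegree m = k)"

inductive_set H_alg :: "diff_poly set" where
  const: "Poly_Mapping.single 0 c \<in> H_alg"
| gen: "j \<ge> 1 \<Longrightarrow> hvar 0 ^ (j - 1) * hvar j \<in> H_alg"
| add: "p \<in> H_alg \<Longrightarrow> q \<in> H_alg \<Longrightarrow> p + q \<in> H_alg"
| mult: "p \<in> H_alg \<Longrightarrow> q \<in> H_alg \<Longrightarrow> p * q \<in> H_alg"

definition H_hom :: "nat \<Rightarrow> diff_poly set" where
  "H_hom k = {0} \<union> {p \<in> H_alg. homogeneous k p}"

text \<open>The pair \<open>(p, q)\<close> stands for the tensor \<open>V\<^sub>0 p + V\<^sub>1 q\<close>.\<close>

definition VH :: "nat \<Rightarrow> (diff_poly \<times> diff_poly) set" where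
  "VH k = H_hom k \<times> H_hom k"

definition subst_poly :: "(real \<Rightarrow> real) \<Rightarrow> diff_poly \<Rightarrow> real \<Rightarrow> real" where
  "subst_poly h p x =
     (\<Sum>m\<in>Poly_Mapping.keys p. of_rat (Poly_Mapping.lookup p m) *
        (\<Prod>j\<in>Poly_Mapping.keys m. (deriv ^^ j) h x ^ Poly_Mapping.lookup m j))"

definition subst_VH :: "(real \<Rightarrow> real) \<Rightarrow> real \<Rightarrow> real \<Rightarrow> diff_poly \<times> diff_poly \<Rightarrow> real \<Rightarrow> real" where
  "subst_VH h V0 V1 t x = V0 * subst_poly h (fst t) x + V1 * subst_poly h (snd t) x"

end

theory Submission
  imports Defs
begin

text \<open>
  The reason behind the theorem is that the algebra is stable under the operator \<open>h \<partial>\<^sub>x\<close>, which raises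
  the superdegree by one: on a generator, \<open>h \<partial>\<^sub>x (h\<^sup>j\<^sup>-\<^sup>1 h\<^sub>j) = (j - 1) h\<^sub>1 (h\<^sup>j\<^sup>-\<^sup>1 h\<^sub>j) + h\<^sup>j h\<^sub>j\<^sub>+\<^sub>1\<close>, and
  \<open>h \<partial>\<^sub>x\<close> is a derivation. Consequently the derivative of \<open>p / h\<^sup>n\<close> is \<open>q / h\<^sup>n\<^sup>+\<^sup>1\<close> with
  \<open>q = h \<partial>\<^sub>x p - n h\<^sub>1 p\<close>, and \<open>q\<close> has superdegree \<open>k + 1\<close> if \<open>p\<close> has superdegree \<open>k\<close>
  (lemmas \<open>H_hom_weighted_D\<close> and \<open>weighted_subst_poly_has_derivative\<close>). Since \<open>p\<close> of
  superdegree \<open>k\<close> involves only derivatives of \<open>h\<close> up to order \<open>k\<close>, the regularity \<open>C\<^sup>2\<^sup>k\<close> is exactly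
  what is needed to differentiate the earlier terms.

  Suppose that the earlier terms are sums of \<open>c\<^sub>n (y/h)\<^sup>n\<close> with \<open>c\<^sub>n\<close> in the algebra, or in
  \<open>h\<close> times the algebra, which only lowers the weight \<open>n\<close> by one. Then
  \<open>-2 \<psi>\<^sub>x\<^sub>x\<^sub>y\<^sub>y\<close>, integrated four times in \<open>y\<close>, turns \<open>c\<^sub>n (y/h)\<^sup>n\<close> into a multiple of
  \<open>q (y/h)\<^sup>n\<^sup>+\<^sup>2\<close>, where the superdegree of \<open>q\<close> is larger by 2, and \<open>-\<psi>\<^sub>x\<^sub>x\<^sub>x\<^sub>x\<close> produces in the same way
  \<open>(y/h)\<^sup>n\<^sup>+\<^sup>4\<close> and superdegree larger by 4. This gives all coefficients with index at least 4 (lemma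
  \<open>Vop4_source\<close>); those of index 1, 2, 3 are determined by the boundary conditions and are
  linear combinations of the others, of \<open>Q\<close> and of \<open>h g\<^sub>0\<close>, \<open>h g\<^sub>1\<close> (lemma \<open>G_of_sum_powers\<close>).

  This recursion is linear and is driven by three kinds of data, \<open>V\<^sub>0\<close>, \<open>V\<^sub>1\<close> and the numbers \<open>Q\<^sup>(\<^sup>2\<^sup>l\<^sup>)\<close>.
  It is therefore solved once, formally, for each kind (\<open>coef\<close> with the boundary data
  \<open>source0\<close>, \<open>source1\<close>, \<open>sourceQ\<close>). Because \<open>Q\<^sup>(\<^sup>2\<^sup>l\<^sup>)\<close> enters at level \<open>l\<close> by way of the same quadratic and
  cubic terms for every \<open>l\<close>, its effect at level \<open>k\<close> is the shifted solution \<open>\<beta>\<^sup>(\<^sup>2\<^sup>k\<^sup>-\<^sup>2\<^sup>l\<^sup>)\<close>, and superposition yields the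
  formula for \<open>\<psi>\<^sup>(\<^sup>2\<^sup>k\<^sup>)\<close>. Finally, \<open>2 Q\<^sup>(\<^sup>2\<^sup>k\<^sup>)\<close> plus the cubic coefficient, divided by \<open>h\<^sup>3\<close>, is precisely the
  integrand in the definition of \<open>Q\<^sup>(\<^sup>2\<^sup>k\<^sup>)\<close>; the summand \<open>l = k\<close> of the cubic coefficient is
  \<open>-2 Q\<^sup>(\<^sup>2\<^sup>k\<^sup>)\<close>, so that only the earlier \<open>Q\<^sup>(\<^sup>2\<^sup>l\<^sup>)\<close> remain.
\<close>

section \<open>Substitution into differential polynomials\<close>

text \<open>
  Identities that are additive in each argument need to be checked on monomials only.
\<close>

lemma diff_poly_induct [case_names zero single add]:
  fixes p :: diff_poly
  assumes "P 0" "\<And>m c. P (Poly_Mapping.single m c)" "\<And>p q. P p \<Longrightarrow> P q \<Longrightarrow> P (p + q)"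
  shows "P p"
proof (induction p rule: update_induct)
  case const
  then show ?case by (rule assms(1))
next
  case (update f a b)
  have "Poly_Mapping.update a b f = f + Poly_Mapping.single a b"
    using update(1) by (intro poly_mapping_eqI) (auto simp: lookup_update lookup_add lookup_single when_def in_keys_iff)
  then show ?case using update assms by simp
qed

definition monom_at :: "(nat \<Rightarrow> real) \<Rightarrow> diff_monom \<Rightarrow> real" where
  "monom_at u m = (\<Prod>j\<in>Poly_Mapping.keys m. u j ^ Poly_Mapping.lookup m j)"

lemma monom_at_superset:
  assumes "finite J" "Poly_Mapping.keys m \<subseteq> J"
  shows "monom_at u m = (\<Prod>j\<in>J. u j ^ Poly_Mapping.lookup m j)"
  unfolding monom_at_def using assms
  by (intro prod.mono_neutral_left) (auto simp: in_keys_iff)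

lemma monom_at_0 [simp]: "monom_at u 0 = 1"
  by (simp add: monom_at_def)

lemma monom_at_single [simp]: "monom_at u (Poly_Mapping.single j n) = u j ^ n"
  by (simp add: monom_at_def)

lemma monom_at_add: "monom_at u (m + n) = monom_at u m * monom_at u n"
proof -
  let ?J = "Poly_Mapping.keys m \<union> Poly_Mapping.keys n"
  have "Poly_Mapping.keys (m + n) \<subseteq> ?J" by (rule keys_add)
  then show ?thesis
    by (simp add: monom_at_superset[of ?J] lookup_add power_add prod.distrib)
qed

lemma subst_poly_monom_at:
  "subst_poly h p x = (\<Sum>m\<in>Poly_Mapping.keys p.
     of_rat (Poly_Mapping.lookup p m) * monom_at (\<lambda>j. (deriv ^^ j) h x) m)"
  by (simp add: subst_poly_def monom_at_def)

lemma subst_poly_0 [simp]: "subst_poly h 0 x = 0"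
  by (simp add: subst_poly_def)

lemma subst_poly_single:
  "subst_poly h (Poly_Mapping.single m c) x = of_rat c * monom_at (\<lambda>j. (deriv ^^ j) h x) m"
  by (simp add: subst_poly_monom_at)

lemma subst_poly_const [simp]: "subst_poly h (Poly_Mapping.single 0 c) x = of_rat c"
  by (simp add: subst_poly_single)

lemma subst_poly_add [simp]: "subst_poly h (p + q) x = subst_poly h p x + subst_poly h q x"
  unfolding subst_poly_monom_at
  by (rule setsum_keys_plus_distrib) (auto simp: of_rat_add algebra_simps)

lemma subst_poly_uminus [simp]: "subst_poly h (- p) x = - subst_poly h p x"
proof -
  have "subst_poly h (- p + p) x = 0" by simp
  then show ?thesis unfolding subst_poly_add by simp
qed

lemma subst_poly_diff [simp]: "subst_poly h (p - q) x = subst_poly h p x - subst_poly h q x"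
  using subst_poly_add[of h p "- q" x] by simp

lemma subst_poly_sum [simp]: "subst_poly h (sum f S) x = (\<Sum>i\<in>S. subst_poly h (f i) x)"
  by (induction S rule: infinite_finite_induct) auto

lemma subst_poly_mult [simp]: "subst_poly h (p * q) x = subst_poly h p x * subst_poly h q x"
proof (induction p rule: diff_poly_induct)
  case (single m c)
  show ?case
    by (induction q rule: diff_poly_induct)
       (auto simp: mult_single subst_poly_single monom_at_add of_rat_mult distrib_left)
qed (auto simp: distrib_right)

lemma subst_poly_1 [simp]: "subst_poly h 1 x = 1"
  using subst_poly_const[of h 1 x] by (simp del: subst_poly_const)

lemma subst_poly_power [simp]: "subst_poly h (p ^ n) x = subst_poly h p x ^ n"
  by (induction n) auto

lemma subst_poly_hvar [simp]: "subst_poly h (hvar j) x = (deriv ^^ j) h x"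
  by (simp add: hvar_def subst_poly_single)

section \<open>The formal total derivative\<close>

definition D_monom :: "diff_monom \<Rightarrow> diff_poly" where
  "D_monom m = (\<Sum>j\<in>Poly_Mapping.keys m. Poly_Mapping.single
     (m - Poly_Mapping.single j 1 + Poly_Mapping.single (Suc j) 1) (of_nat (Poly_Mapping.lookup m j)))"

definition D :: "diff_poly \<Rightarrow> diff_poly" where
  "D p = (\<Sum>m\<in>Poly_Mapping.keys p. Poly_Mapping.single 0 (Poly_Mapping.lookup p m) * D_monom m)"

lemma D_0 [simp]: "D 0 = 0"
  by (simp add: D_def)

lemma D_single: "D (Poly_Mapping.single m c) = Poly_Mapping.single 0 c * D_monom m"
  by (simp add: D_def)

lemma D_add [simp]: "D (p + q) = D p + D q"
  unfolding D_def
  by (rule setsum_keys_plus_distrib) (auto simp: single_add algebra_simps)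

lemma D_const [simp]: "D (Poly_Mapping.single 0 c) = 0"
  by (simp add: D_single D_monom_def)

lemma D_hvar [simp]: "D (hvar j) = hvar (Suc j)"
  by (simp add: hvar_def D_single D_monom_def)

lemma D_monom_superset:
  assumes "finite J" "Poly_Mapping.keys m \<subseteq> J"
  shows "D_monom m = (\<Sum>j\<in>J. Poly_Mapping.single
     (m - Poly_Mapping.single j 1 + Poly_Mapping.single (Suc j) 1) (of_nat (Poly_Mapping.lookup m j)))"
  unfolding D_monom_def using assms
  by (intro sum.mono_neutral_left) (auto simp: in_keys_iff)

lemma diff_monom_cancel:
  fixes m :: diff_monom
  assumes "Poly_Mapping.lookup m j \<noteq> 0"
  shows "m = (m - Poly_Mapping.single j 1) + Poly_Mapping.single j 1"
  using assms by (intro poly_mapping_eqI) (auto simp: lookup_add lookup_minus lookup_single when_def)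

text \<open>
  The Leibniz rule on monomials. In \<open>D_monom\<close> the subtraction of exponents is truncated, but a
  term with truncation carries the coefficient 0.
\<close>

lemma D_monom_add:
  "D_monom (m + n) = D_monom m * Poly_Mapping.single n 1 + Poly_Mapping.single m 1 * D_monom n"
proof -
  let ?J = "Poly_Mapping.keys m \<union> Poly_Mapping.keys n"
  define up :: "nat \<Rightarrow> diff_monom" where "up j = Poly_Mapping.single (Suc j) 1" for j
  define e :: "nat \<Rightarrow> diff_monom" where "e j = Poly_Mapping.single j 1" for j
  have split: "Poly_Mapping.single (m + n - e j + up j) (of_nat (Poly_Mapping.lookup (m + n) j)) =
      (Poly_Mapping.single (m - e j + up j) (of_nat (Poly_Mapping.lookup m j)) * Poly_Mapping.single n 1
       + Poly_Mapping.single m 1 * Poly_Mapping.single (n - e j + up j) (of_nat (Poly_Mapping.lookup n j)) :: diff_poly)"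
    for j
  proof -
    have m: "m + n - e j + up j = (m - e j + up j) + n" if "Poly_Mapping.lookup m j \<noteq> 0"
    proof -
      have "m = (m - e j) + e j"
        using diff_monom_cancel[OF that] by (simp add: e_def)
      then show ?thesis
        by (metis (no_types, lifting) add.assoc add.commute add_diff_cancel_right')
    qed
    have n: "m + n - e j + up j = m + (n - e j + up j)" if "Poly_Mapping.lookup n j \<noteq> 0"
    proof -
      have "n = (n - e j) + e j"
        using diff_monom_cancel[OF that] by (simp add: e_def)
      then show ?thesis
        by (metis (no_types, lifting) add.assoc add_diff_cancel_right')
    qed
    show ?thesis
      by (cases "Poly_Mapping.lookup m j = 0"; cases "Poly_Mapping.lookup n j = 0")
         (simp_all add: mult_single lookup_add single_add m n flip: m n)
  qed
  have "Poly_Mapping.keys (m + n) \<subseteq> ?J" by (rule keys_add)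
  then have "D_monom (m + n) = (\<Sum>j\<in>?J. Poly_Mapping.single (m + n - e j + up j) (of_nat (Poly_Mapping.lookup (m + n) j)))"
    by (simp add: D_monom_superset[of ?J] e_def up_def)
  also have "\<dots> = D_monom m * Poly_Mapping.single n 1 + Poly_Mapping.single m 1 * D_monom n"
    by (simp only: split sum.distrib sum_distrib_left[symmetric] sum_distrib_right[symmetric])
       (simp add: D_monom_superset[of ?J] e_def up_def)
  finally show ?thesis .
qed

lemma D_mult: "D (p * q) = D p * q + p * D q"
proof (induction p rule: diff_poly_induct)
  case (single m c)
  show ?case
  proof (induction q rule: diff_poly_induct)
    case (single n d)
    have eq: "Poly_Mapping.single k r = Poly_Mapping.single 0 r * Poly_Mapping.single k 1" for k :: diff_monom and r :: rat
      by (simp add: mult_single)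
    show ?case
      unfolding mult_single D_single D_monom_add
      by (subst (3 5) eq) (simp add: distrib_left mult_single algebra_simps flip: mult_single[of 0 c 0 d, simplified])
  qed (auto simp: distrib_left algebra_simps)
qed (auto simp: distrib_right algebra_simps)

section \<open>Homogeneous elements of the algebra\<close>

lemma superdegree_superset:
  assumes "finite J" "Poly_Mapping.keys m \<subseteq> J"
  shows "superdegree m = (\<Sum>j\<in>J. j * Poly_Mapping.lookup m j)"
  unfolding superdegree_def using assms
  by (intro sum.mono_neutral_left) (auto simp: in_keys_iff)

lemma superdegree_add: "superdegree (m + n) = superdegree m + superdegree n"
proof -
  let ?J = "Poly_Mapping.keys m \<union> Poly_Mapping.keys n"
  have "Poly_Mapping.keys (m + n) \<subseteq> ?J" by (rule keys_add)
  then show ?thesis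
    by (simp add: superdegree_superset[of ?J] lookup_add distrib_left sum.distrib)
qed

lemma superdegree_0 [simp]: "superdegree 0 = 0"
  by (simp add: superdegree_def)

lemma superdegree_single [simp]: "superdegree (Poly_Mapping.single j n) = j * n"
  by (simp add: superdegree_def)

text \<open>
  A monomial of superdegree \<open>k\<close> involves only derivatives up to order \<open>k\<close>.
\<close>

lemma superdegree_bound: "j \<in> Poly_Mapping.keys m \<Longrightarrow> j \<le> superdegree m"
proof -
  assume j: "j \<in> Poly_Mapping.keys m"
  then have "j * 1 \<le> j * Poly_Mapping.lookup m j"
    by (intro mult_le_mono2) (simp add: in_keys_iff Suc_le_eq)
  also have "\<dots> \<le> superdegree m"
    unfolding superdegree_def using j by (intro member_le_sum) auto
  finally show ?thesis by simp
qed

lemma homogeneous_add: "homogeneous k p \<Longrightarrow> homogeneous k q \<Longrightarrow> homogeneous k (p + q)"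
  unfolding homogeneous_def using keys_add[of p q] by blast

lemma homogeneous_sum: "(\<And>i. i \<in> S \<Longrightarrow> homogeneous k (f i)) \<Longrightarrow> homogeneous k (sum f S)"
  proof (induction S rule: infinite_finite_induct)
  case (insert i S)
  then show ?case by (simp add: homogeneous_add)
qed (simp_all add: homogeneous_def)

lemma homogeneous_mult:
  "homogeneous k p \<Longrightarrow> homogeneous l q \<Longrightarrow> homogeneous (k + l) (p * q)"
  unfolding homogeneous_def using keys_mult[of p q] by (fastforce simp: superdegree_add)

lemma homogeneous_single: "homogeneous (superdegree m) (Poly_Mapping.single m c)"
  by (simp add: homogeneous_def)

lemma homogeneous_const: "homogeneous 0 (Poly_Mapping.single 0 c)"
  using homogeneous_single[of 0 c] by simp

lemma homogeneous_hvar: "homogeneous j (hvar j)"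
  using homogeneous_single[of "Poly_Mapping.single j 1" 1] by (simp add: hvar_def)

lemma homogeneous_D_monom: "homogeneous (Suc (superdegree m)) (D_monom m)"
  unfolding D_monom_def
proof (intro homogeneous_sum)
  fix j assume "j \<in> Poly_Mapping.keys m"
  then have m: "m = (m - Poly_Mapping.single j 1) + Poly_Mapping.single j 1"
    by (intro diff_monom_cancel) (simp add: in_keys_iff)
  have "superdegree (m - Poly_Mapping.single j 1 + Poly_Mapping.single (Suc j) 1) = Suc (superdegree m)"
    by (subst (2) m) (simp add: superdegree_add)
  then show "homogeneous (Suc (superdegree m)) (Poly_Mapping.single
      (m - Poly_Mapping.single j 1 + Poly_Mapping.single (Suc j) 1) (of_nat (Poly_Mapping.lookup m j)))"
    using homogeneous_single by metis
qed

lemma homogeneous_D: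
  assumes "homogeneous k p"
  shows "homogeneous (Suc k) (D p)"
  unfolding D_def
proof (intro homogeneous_sum)
  fix m assume "m \<in> Poly_Mapping.keys p"
  then have "superdegree m = k" using assms by (simp add: homogeneous_def)
  then show "homogeneous (Suc k) (Poly_Mapping.single 0 (Poly_Mapping.lookup p m) * D_monom m)"
    using homogeneous_mult[OF homogeneous_const homogeneous_D_monom[of m]] by simp
qed

lemma H_hom_iff: "p \<in> H_hom k \<longleftrightarrow> p \<in> H_alg \<and> homogeneous k p"
  using H_alg.const[of 0] by (auto simp: H_hom_def homogeneous_def)

lemma H_hom_0 [simp]: "0 \<in> H_hom k"
  by (simp add: H_hom_def)

lemma H_hom_const: "Poly_Mapping.single 0 c \<in> H_hom 0"
  by (simp add: H_hom_iff H_alg.const homogeneous_const)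

lemma H_hom_1: "1 \<in> H_hom 0"
  using H_hom_const[of 1] by simp

lemma H_hom_add: "p \<in> H_hom k \<Longrightarrow> q \<in> H_hom k \<Longrightarrow> p + q \<in> H_hom k"
  by (simp add: H_hom_iff H_alg.add homogeneous_add)

lemma H_hom_mult: "p \<in> H_hom k \<Longrightarrow> q \<in> H_hom l \<Longrightarrow> p * q \<in> H_hom (k + l)"
  by (simp add: H_hom_iff H_alg.mult homogeneous_mult)

lemma H_hom_scale: "p \<in> H_hom k \<Longrightarrow> Poly_Mapping.single 0 c * p \<in> H_hom k"
  using H_hom_mult[OF H_hom_const] by simp

lemma H_hom_uminus: "p \<in> H_hom k \<Longrightarrow> - p \<in> H_hom k"
  using H_hom_scale[of p k "-1"] by (simp add: single_uminus)

lemma H_hom_diff: "p \<in> H_hom k \<Longrightarrow> q \<in> H_hom k \<Longrightarrow> p - q \<in> H_hom k"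
  using H_hom_add[OF _ H_hom_uminus] by fastforce

lemma H_hom_sum: "(\<And>i. i \<in> S \<Longrightarrow> f i \<in> H_hom k) \<Longrightarrow> sum f S \<in> H_hom k"
  by (induction S rule: infinite_finite_induct) (auto intro: H_hom_add)

lemma H_hom_h1: "hvar 1 \<in> H_hom 1"
  using H_alg.gen[of 1] by (simp add: H_hom_iff homogeneous_hvar)

lemma H_hom_h1_power: "hvar 1 ^ n \<in> H_hom n"
  by (induction n) (use H_hom_1 H_hom_mult[OF H_hom_h1] in auto)

text \<open>
  The central closure property. A derivation that maps every generator into the algebra
  preserves the algebra; the generator \<open>h\<^sup>j\<^sup>-\<^sup>1 h\<^sub>j\<close> is mapped to
  \<open>(j - 1) h\<^sub>1 (h\<^sup>j\<^sup>-\<^sup>1 h\<^sub>j) + h\<^sup>j h\<^sub>j\<^sub>+\<^sub>1\<close>.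
\<close>

lemma H_alg_D: "p \<in> H_alg \<Longrightarrow> hvar 0 * D p \<in> H_alg"
proof (induction rule: H_alg.induct)
  case (const c)
  then show ?case using H_alg.const[of 0] by simp
next
  case (gen j)
  have pow: "D (hvar 0 ^ n) * hvar 0 = Poly_Mapping.single 0 (of_nat n) * hvar 0 ^ n * hvar 1" for n
  proof (induction n)
    case 0
    show ?case using D_const[of 1] by simp
  next
    case (Suc n)
    then show ?case by (simp add: D_mult single_add algebra_simps del: single_of_nat)
  qed
  obtain i where j: "j = Suc i" using gen by (cases j) auto
  have "hvar 0 * D (hvar 0 ^ (j - 1) * hvar j)
      = (D (hvar 0 ^ i) * hvar 0) * hvar j + hvar 0 ^ j * hvar (Suc j)"
    by (simp add: j D_mult algebra_simps)
  also have "\<dots> = Poly_Mapping.single 0 (of_nat i) * (hvar 0 ^ (1 - 1) * hvar 1) * (hvar 0 ^ (j - 1) * hvar j)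
      + hvar 0 ^ (Suc j - 1) * hvar (Suc j)"
    unfolding pow by (simp add: j algebra_simps)
  also have "\<dots> \<in> H_alg"
    using gen by (intro H_alg.intros) auto
  finally show ?case .
next
  case (add p q)
  then show ?case by (simp add: distrib_left H_alg.add)
next
  case (mult p q)
  have "hvar 0 * D (p * q) = (hvar 0 * D p) * q + p * (hvar 0 * D q)"
    by (simp add: D_mult algebra_simps)
  with mult show ?case by (simp add: H_alg.add H_alg.mult)
qed

lemma H_hom_D: "p \<in> H_hom k \<Longrightarrow> hvar 0 * D p \<in> H_hom (Suc k)"
  using homogeneous_mult[OF homogeneous_hvar[of 0] homogeneous_D] H_alg_D
  by (simp add: H_hom_iff)

text \<open>
  The operator \<open>p \<mapsto> h\<^sup>n\<^sup>+\<^sup>1 \<partial>\<^sub>x (h\<^sup>-\<^sup>n p)\<close>.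
\<close>

definition weighted_D :: "nat \<Rightarrow> diff_poly \<Rightarrow> diff_poly" where
  "weighted_D n p = hvar 0 * D p - Poly_Mapping.single 0 (of_nat n) * hvar 1 * p"

text \<open>
  The operator \<open>p \<mapsto> h\<^sup>n\<^sup>+\<^sup>i \<partial>\<^sub>x\<^sup>i (h\<^sup>-\<^sup>n p)\<close>; the weight grows by one with each derivative.
\<close>

fun weighted_Ds :: "nat \<Rightarrow> nat \<Rightarrow> diff_poly \<Rightarrow> diff_poly" where
  "weighted_Ds n 0 p = p"
| "weighted_Ds n (Suc i) p = weighted_D (n + i) (weighted_Ds n i p)"

lemma weighted_D_0 [simp]: "weighted_D n 0 = 0"
  by (simp add: weighted_D_def)

lemma weighted_Ds_0 [simp]: "weighted_Ds n i 0 = 0"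
  by (induction i) auto

lemma H_hom_weighted_D:
  assumes "p \<in> H_hom k"
  shows "weighted_D n p \<in> H_hom (Suc k)"
  using H_hom_diff[OF H_hom_D[OF assms]] H_hom_scale[OF H_hom_mult[OF H_hom_h1 assms]]
  by (simp add: weighted_D_def mult.assoc del: single_of_nat)

lemma H_hom_weighted_Ds: "p \<in> H_hom k \<Longrightarrow> weighted_Ds n i p \<in> H_hom (k + i)"
  by (induction i) (auto intro: H_hom_weighted_D)

section \<open>Derivatives of substituted polynomials\<close>

lemma D_monom_has_derivative:
  assumes "\<And>j. j \<in> Poly_Mapping.keys m \<Longrightarrow> (deriv ^^ j) h field_differentiable at x"
  shows "((\<lambda>t. monom_at (\<lambda>j. (deriv ^^ j) h t) m) has_field_derivative subst_poly h (D_monom m) x) (at x)"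
  using assms
proof (induction m rule: update_induct)
  case const
  show ?case by (simp add: D_monom_def)
next
  case (update m j n)
  let ?s = "Poly_Mapping.single j n"
  have m: "Poly_Mapping.update j n m = m + ?s"
    using update(1) by (intro poly_mapping_eqI) (auto simp: lookup_update lookup_add lookup_single when_def in_keys_iff)
  have "((deriv ^^ j) h has_field_derivative (deriv ^^ Suc j) h x) (at x)"
    using update by (simp add: DERIV_deriv_iff_field_differentiable keys_update)
  moreover have "?s - Poly_Mapping.single j 1 = Poly_Mapping.single j (n - 1)"
    by (simp add: single_diff)
  ultimately have s: "((\<lambda>t. monom_at (\<lambda>j. (deriv ^^ j) h t) ?s) has_field_derivative subst_poly h (D_monom ?s) x) (at x)"
    using update(2)
    by (auto intro!: derivative_eq_intros simp: D_monom_def subst_poly_single monom_at_add)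
  have "((\<lambda>t. monom_at (\<lambda>j. (deriv ^^ j) h t) m) has_field_derivative subst_poly h (D_monom m) x) (at x)"
    using update by (simp add: keys_update)
  from DERIV_mult[OF this s] show ?case
    by (simp add: m monom_at_add D_monom_add subst_poly_single mult.commute)
qed

lemma subst_poly_has_derivative:
  assumes "\<And>m j. m \<in> Poly_Mapping.keys p \<Longrightarrow> j \<in> Poly_Mapping.keys m \<Longrightarrow> (deriv ^^ j) h field_differentiable at x"
  shows "(subst_poly h p has_field_derivative subst_poly h (D p) x) (at x)"
proof -
  have "subst_poly h p = (\<lambda>t. \<Sum>m\<in>Poly_Mapping.keys p.
      of_rat (Poly_Mapping.lookup p m) * monom_at (\<lambda>j. (deriv ^^ j) h t) m)"
    by (simp add: fun_eq_iff subst_poly_monom_at)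
  then show ?thesis
    unfolding D_def subst_poly_sum subst_poly_mult subst_poly_const
    by (auto intro!: DERIV_sum DERIV_cmult D_monom_has_derivative assms)
qed

lemma weighted_subst_poly_has_derivative:
  assumes "homogeneous k p" "\<And>j. j \<le> k \<Longrightarrow> (deriv ^^ j) h field_differentiable at x" "h x \<noteq> 0"
  shows "((\<lambda>t. subst_poly h p t / h t ^ n) has_field_derivative subst_poly h (weighted_D n p) x / h x ^ Suc n) (at x)"
proof -
  have "j \<le> k" if "m \<in> Poly_Mapping.keys p" "j \<in> Poly_Mapping.keys m" for m j
    using that assms(1) superdegree_bound[of j m] by (auto simp: homogeneous_def)
  then have p: "(subst_poly h p has_field_derivative subst_poly h (D p) x) (at x)"
    using assms(2) by (intro subst_poly_has_derivative) blast
  have h: "(h has_field_derivative deriv h x) (at x)"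
    using assms(2)[of 0] by (simp add: DERIV_deriv_iff_field_differentiable)
  have power: "n > 0 \<Longrightarrow> h x * h x ^ (n - Suc 0) = h x ^ n"
    by (cases n) auto
  show ?thesis
    using assms(3)
    by (rule_tac derivative_eq_intros p h DERIV_power refl power_not_zero | assumption)+
       (auto simp: weighted_D_def field_simps power simp del: single_of_nat)
qed

lemma weighted_iterated_derivative:
  assumes "p \<in> H_hom k" "\<And>j. j \<le> k + i \<Longrightarrow> (deriv ^^ j) h field_differentiable at x" "h x \<noteq> 0"
  shows "((\<lambda>t. subst_poly h (weighted_Ds n i p) t / h t ^ (n + i)) has_field_derivative
          subst_poly h (weighted_Ds n (Suc i) p) x / h x ^ (n + Suc i)) (at x)"
  using weighted_subst_poly_has_derivative[of "k + i" "weighted_Ds n i p" h x "n + i"] H_hom_weighted_Ds[OF assms(1), of n i] assms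
  by (simp add: H_hom_iff)

text \<open>
  At the top order, where \<open>h\<^sup>(\<^sup>k\<^sup>)\<close> is continuous but possibly not differentiable, the
  coefficients are still continuous. This makes the integrands for \<open>Q\<close> integrable.
\<close>

lemma continuous_on_subst_poly:
  assumes "homogeneous k p" "\<And>j. j \<le> k \<Longrightarrow> continuous_on S ((deriv ^^ j) h)"
  shows "continuous_on S (subst_poly h p)"
proof -
  have "j \<le> k" if "m \<in> Poly_Mapping.keys p" "j \<in> Poly_Mapping.keys m" for m j
    using that assms(1) superdegree_bound[of j m] by (auto simp: homogeneous_def)
  then show ?thesis
    unfolding subst_poly_def[abs_def]
    by (intro continuous_intros assms(2))
qed

section \<open>The formal coefficient recursion\<close>

text \<open>
  The coefficients of \<open>h\<^sup>e (y/h)\<^sup>m\<close> in the fourfold integral of \<open>-2 \<psi>\<^sub>x\<^sub>x\<^sub>y\<^sub>y - \<phi>\<^sub>x\<^sub>x\<^sub>x\<^sub>x\<close>,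
  where \<open>p\<close> and \<open>q\<close> are the coefficients of \<open>\<psi>\<close> and \<open>\<phi>\<close>. The exponent \<open>e\<close> is 1 for the parts
  that are proportional to \<open>V\<^sub>0\<close> and \<open>V\<^sub>1\<close>, whose coefficients carry an extra factor \<open>h\<close>, and 0
  for the parts that are proportional to some \<open>Q\<close>. The case distinction says that \<open>\<phi>\<close> has no
  term of index 0.
\<close>

definition interior_coef :: "nat \<Rightarrow> (nat \<Rightarrow> diff_poly) \<Rightarrow> (nat \<Rightarrow> diff_poly) \<Rightarrow> nat \<Rightarrow> diff_poly" where
  "interior_coef e p q m =
     Poly_Mapping.single 0 (- 2 / (of_nat m * (of_nat m - 1))) * weighted_Ds (m - 2 - e) 2 (p (m - 2))
     - (if m < 5 then 0 else
        Poly_Mapping.single 0 (1 / (of_nat m * (of_nat m - 1) * (of_nat m - 2) * (of_nat m - 3)))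
          * weighted_Ds (m - 4 - e) 4 (q (m - 4)))"

text \<open>
  The terms of index 2 and 3 make the value and the \<open>y\<close>-derivative of the sum over \<open>m\<close> vanish at
  \<open>y = h\<close>: adding \<open>(m - 3) (y/h)\<^sup>2 + (2 - m) (y/h)\<^sup>3\<close> to \<open>(y/h)\<^sup>m\<close> has this effect. The function
  \<open>s\<close> contains what the boundary data contribute.
\<close>

definition with_boundary :: "(nat \<Rightarrow> diff_poly) \<Rightarrow> nat \<Rightarrow> (nat \<Rightarrow> diff_poly) \<Rightarrow> nat \<Rightarrow> diff_poly" where
  "with_boundary s M r n =
     (if 4 \<le> n then r n
      else s n +
        (if n = 2 then (\<Sum>m=4..M. Poly_Mapping.single 0 (of_nat m - 3) * r m)
         else if n = 3 then (\<Sum>m=4..M. Poly_Mapping.single 0 (2 - of_nat m) * r m)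
         else 0))"

fun coef :: "nat \<Rightarrow> (nat \<Rightarrow> nat \<Rightarrow> diff_poly) \<Rightarrow> nat \<Rightarrow> nat \<Rightarrow> diff_poly" where
  "coef e s 0 n = with_boundary (s 0) 3 (\<lambda>_. 0) n"
| "coef e s (Suc k) n = with_boundary (s (Suc k)) (2 * k + 5)
     (interior_coef e (coef e s k) (case k of 0 \<Rightarrow> (\<lambda>_. 0) | Suc j \<Rightarrow> coef e s j)) n"

lemma coef_eq_0: "n > 2 * k + 3 \<Longrightarrow> coef e s k n = 0"
proof (induction k arbitrary: n rule: less_induct)
  case (less k)
  show ?case
  proof (cases k)
    case 0
    then show ?thesis using less.prems by (simp add: with_boundary_def)
  next
    case (Suc j)
    have "coef e s j (n - 2) = 0"
      using less Suc by simp
    moreover have "(case j of 0 \<Rightarrow> (\<lambda>_. 0) | Suc i \<Rightarrow> coef e s i) (n - 4) = 0"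
      using less Suc by (cases j) auto
    ultimately show ?thesis using less.prems
      by (simp add: Suc with_boundary_def interior_coef_def)
  qed
qed

lemma H_hom_with_boundary:
  assumes "\<And>n. s n \<in> H_hom d" "\<And>n. r n \<in> H_hom d"
  shows "with_boundary s M r n \<in> H_hom d"
  using assms by (auto simp: with_boundary_def intro!: H_hom_add H_hom_sum H_hom_scale)

lemma H_hom_interior_coef:
  assumes "\<And>n. p n \<in> H_hom (d + 2)" "\<And>n. q n \<in> H_hom d"
  shows "interior_coef e p q n \<in> H_hom (d + 4)"
  using H_hom_weighted_Ds[OF assms(1), of _ 2] H_hom_weighted_Ds[OF assms(2), of _ 4]
  by (auto simp: interior_coef_def eval_nat_numeral intro!: H_hom_diff H_hom_scale)

lemma H_hom_coef:
  assumes "\<And>k n. s k n \<in> H_hom (2 * k)"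
  shows "coef e s k n \<in> H_hom (2 * k)"
proof (induction k arbitrary: n rule: less_induct)
  case (less k)
  show ?case
  proof (cases k)
    case 0
    have "with_boundary (s 0) 3 (\<lambda>_. 0) n \<in> H_hom 0"
      using assms[of 0] by (intro H_hom_with_boundary) auto
    with 0 show ?thesis by simp
  next
    case (Suc j)
    have "interior_coef e (coef e s j) (case j of 0 \<Rightarrow> (\<lambda>_. 0) | Suc i \<Rightarrow> coef e s i) n \<in> H_hom (2 * k)" for n
    proof (cases j)
      case 0
      have "coef e s 0 (n - 2) \<in> H_hom 0"
        using less.IH[of 0] Suc by simp
      from H_hom_weighted_Ds[OF this, of "n - 2 - e" 2]
      have "weighted_Ds (n - 2 - e) 2 (coef e s 0 (n - 2)) \<in> H_hom (2 * k)"
        using Suc 0 by (simp del: coef.simps add: numeral_2_eq_2)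
      then show ?thesis
        using 0 by (simp add: interior_coef_def H_hom_scale del: coef.simps)
    next
      case (Suc i)
      then show ?thesis
        using less.IH[of j] less.IH[of i] \<open>k = Suc j\<close> H_hom_interior_coef[of "coef e s j" "2 * i" "coef e s i" e n]
        by (simp del: coef.simps add: eval_nat_numeral)
    qed
    moreover have "s (Suc j) n \<in> H_hom (2 * k)" for n
      using assms[of "Suc j"] Suc by simp
    ultimately show ?thesis
      unfolding Suc by (simp add: H_hom_with_boundary)
  qed
qed

section \<open>Sums of powers of \<open>y\<close>\<close>

text \<open>
  All identities for \<open>\<psi>\<close> are established for every \<open>y > 0\<close> and not only below the graph of \<open>h\<close>.
  The domain of validity is then a half-plane, so that \<open>x\<close>-derivatives at fixed \<open>y\<close> can be taken
  termwise. Negative \<open>y\<close> are excluded because there the integrals \<open>Vop\<close> are 0, not given by the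
  polynomials.
\<close>

lemma dx_sum_powers:
  assumes f: "\<And>x y. y > 0 \<Longrightarrow> f x y = (\<Sum>n\<in>S. C n x * y ^ r n)"
    and C: "\<And>n x. n \<in> S \<Longrightarrow> (C n has_field_derivative C' n x) (at x)"
    and "y > 0"
  shows "dx f x y = (\<Sum>n\<in>S. C' n x * y ^ r n)"
proof -
  have "(\<lambda>t. f t y) = (\<lambda>t. \<Sum>n\<in>S. C n t * y ^ r n)"
    using f \<open>y > 0\<close> by auto
  moreover have "((\<lambda>t. \<Sum>n\<in>S. C n t * y ^ r n) has_field_derivative (\<Sum>n\<in>S. C' n x * y ^ r n)) (at x)"
    by (intro DERIV_sum DERIV_cmult_right C)
  ultimately show ?thesis
    by (simp add: dx_def DERIV_imp_deriv)
qed

lemma sum_powers_has_derivative: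
  fixes g :: "real \<Rightarrow> real"
  assumes g: "\<And>y. y > 0 \<Longrightarrow> g y = (\<Sum>n\<in>S. c n * y ^ r n)" and "y > 0"
  shows "(g has_field_derivative (\<Sum>n\<in>S. c n * real (r n) * y ^ (r n - 1))) (at y)"
proof (rule has_field_derivative_transform_within_open)
  show "((\<lambda>y. \<Sum>n\<in>S. c n * y ^ r n) has_field_derivative (\<Sum>n\<in>S. c n * real (r n) * y ^ (r n - 1))) (at y)"
    by (auto intro!: DERIV_sum derivative_eq_intros)
  show "open {0::real<..}" "y \<in> {0<..}" using \<open>y > 0\<close> by auto
qed (use g in auto)

lemma dy_sum_powers:
  assumes "\<And>x y. y > 0 \<Longrightarrow> f x y = (\<Sum>n\<in>S. C n x * y ^ r n)" and "y > 0"
  shows "dy f x y = (\<Sum>n\<in>S. (C n x * real (r n)) * y ^ (r n - 1))"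
  unfolding dy_def using assms
  by (intro DERIV_imp_deriv sum_powers_has_derivative) auto

lemma Vop_sum_powers:
  assumes f: "\<And>x y. y > 0 \<Longrightarrow> f x y = (\<Sum>n\<in>S. C n x * y ^ r n)" and "y > 0"
  shows "Vop f x y = (\<Sum>n\<in>S. (C n x / real (Suc (r n))) * y ^ Suc (r n))"
proof -
  let ?F = "\<lambda>y. \<Sum>n\<in>S. (C n x / real (Suc (r n))) * y ^ Suc (r n)"
  have "((\<lambda>y. \<Sum>n\<in>S. C n x * y ^ r n) has_integral (?F y - ?F 0)) {0..y}"
  proof (rule fundamental_theorem_of_calculus)
    fix t
    have "((\<lambda>y. (C n x / real (Suc (r n))) * y ^ Suc (r n)) has_field_derivative C n x * t ^ r n) (at t within {0..y})" for n
      by (rule derivative_eq_intros refl)+ (simp del: of_nat_Suc)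
    then have "(?F has_field_derivative (\<Sum>n\<in>S. C n x * t ^ r n)) (at t within {0..y})"
      by (intro DERIV_sum)
    then show "(?F has_vector_derivative (\<Sum>n\<in>S. C n x * t ^ r n)) (at t within {0..y})"
      by (simp add: has_real_derivative_iff_has_vector_derivative)
  qed (use \<open>y > 0\<close> in auto)
  then have "((\<lambda>y. \<Sum>n\<in>S. C n x * y ^ r n) has_integral ?F y) {0..y}"
    by simp
  \<comment> \<open>the formula for \<open>f\<close> may fail at the end point 0\<close>
  then have "(f x has_integral ?F y) {0..y}"
    by (rule has_integral_spike_finite[of "{0}", rotated 2]) (use f in auto)
  then show ?thesis
    by (simp add: Vop_def integral_unique)
qed

lemma Vop4_sum_powers:
  assumes "\<And>x y. y > 0 \<Longrightarrow> f x y = (\<Sum>n\<in>S. C n x * y ^ n)" and "y > 0"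
  shows "(Vop ^^ 4) f x y =
    (\<Sum>n\<in>S. C n x / (real (n + 1) * real (n + 2) * real (n + 3) * real (n + 4)) * y ^ (n + 4))"
proof -
  have step: "Vop g x y = (\<Sum>n\<in>S. A n x / real (n + Suc i) * y ^ (n + Suc i))"
    if "y > 0" "\<And>x y. y > 0 \<Longrightarrow> g x y = (\<Sum>n\<in>S. A n x * y ^ (n + i))" for g A i x y
    using Vop_sum_powers[OF that(2,1)] by simp
  have 1: "Vop f x y = (\<Sum>n\<in>S. C n x / real (n + 1) * y ^ (n + 1))" if "y > 0" for x y
    using step[OF that, of f C 0] assms(1) by simp
  have 2: "Vop (Vop f) x y = (\<Sum>n\<in>S. C n x / real (n + 1) / real (n + 2) * y ^ (n + 2))" if "y > 0" for x y
    using step[OF that 1] by simp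
  have 3: "Vop (Vop (Vop f)) x y = (\<Sum>n\<in>S. C n x / real (n + 1) / real (n + 2) / real (n + 3) * y ^ (n + 3))"
    if "y > 0" for x y
    using step[OF that 2] by (simp add: eval_nat_numeral)
  show ?thesis
    using step[OF \<open>y > 0\<close> 3] by (simp add: eval_nat_numeral mult_ac)
qed

text \<open>
  The index \<open>i\<close> of \<open>C n i\<close> and \<open>E n i\<close> counts derivatives in \<open>x\<close>. A term \<open>y\<^sup>n\<close> of \<open>\<psi>\<close>
  contributes to \<open>y\<^sup>n\<^sup>+\<^sup>2\<close>, with \<open>n \<ge> 2\<close> because the second \<open>y\<close>-derivative removes \<open>n = 1\<close>; a
  term \<open>y\<^sup>n\<close> of \<open>\<phi>\<close> contributes to \<open>y\<^sup>n\<^sup>+\<^sup>4\<close>. Hence the lowest index is 4.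
\<close>

lemma Vop4_source:
  assumes \<psi>: "\<And>x y. y > 0 \<Longrightarrow> \<psi> x y = (\<Sum>n=1..N+2. C n 0 x * y ^ n)"
    and \<phi>: "\<And>x y. y > 0 \<Longrightarrow> \<phi> x y = (\<Sum>n=1..N. E n 0 x * y ^ n)"
    and C: "\<And>n i x. n \<in> {1..N+2} \<Longrightarrow> i < 2 \<Longrightarrow> (C n i has_field_derivative C n (Suc i) x) (at x)"
    and E: "\<And>n i x. n \<in> {1..N} \<Longrightarrow> i < 4 \<Longrightarrow> (E n i has_field_derivative E n (Suc i) x) (at x)"
    and "y > 0"
  shows "(Vop ^^ 4) (\<lambda>x y. - 2 * dy (dy (dx (dx \<psi>))) x y - dx (dx (dx (dx \<phi>))) x y) x y =
    (\<Sum>m=4..N+4. (- 2 / (real m * (real m - 1)) * C (m - 2) 2 x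
       - (if m < 5 then 0 else
          1 / (real m * (real m - 1) * (real m - 2) * (real m - 3)) * E (m - 4) 4 x)) * y ^ m)"
proof -
  have \<psi>2: "dx (dx \<psi>) x y = (\<Sum>n=1..N+2. C n 2 x * y ^ n)" if "y > 0" for x y
  proof -
    have step: "dx f x y = (\<Sum>n=1..N+2. C n (Suc i) x * y ^ n)"
      if "i < 2" "y > 0" "\<And>x y. y > 0 \<Longrightarrow> f x y = (\<Sum>n=1..N+2. C n i x * y ^ n)" for f i x y
      using that C by (intro dx_sum_powers[where C = "\<lambda>n. C n i"]) auto
    show ?thesis using that step[OF _ _ step[OF _ _ \<psi>]] by (simp add: numeral_2_eq_2)
  qed
  have \<phi>4: "dx (dx (dx (dx \<phi>))) x y = (\<Sum>n=1..N. E n 4 x * y ^ n)" if "y > 0" for x y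
  proof -
    have step: "dx f x y = (\<Sum>n=1..N. E n (Suc i) x * y ^ n)"
      if "i < 4" "y > 0" "\<And>x y. y > 0 \<Longrightarrow> f x y = (\<Sum>n=1..N. E n i x * y ^ n)" for f i x y
      using that E by (intro dx_sum_powers[where C = "\<lambda>n. E n i"]) auto
    show ?thesis using that step[OF _ _ step[OF _ _ step[OF _ _ step[OF _ _ \<phi>]]]] by (simp add: eval_nat_numeral)
  qed
  have *: "- 2 * dy (dy (dx (dx \<psi>))) x y - dx (dx (dx (dx \<phi>))) x y =
      (\<Sum>n=0..N. (- 2 * real (n + 1) * real (n + 2) * C (n + 2) 2 x - (if n < 1 then 0 else E n 4 x)) * y ^ n)"
    if "y > 0" for x y
  proof -
    have "dy (dx (dx \<psi>)) x y = (\<Sum>n=1..N+2. C n 2 x * real n * y ^ (n - 1))" if "y > 0" for x y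
      using dy_sum_powers[of "dx (dx \<psi>)" "\<lambda>n. C n 2" "\<lambda>n. n" "{1..N+2}"] \<psi>2 that by simp
    then have "dy (dy (dx (dx \<psi>))) x y = (\<Sum>n=1..N+2. C n 2 x * real n * real (n - 1) * y ^ (n - 1 - 1))"
      using dy_sum_powers[of "dy (dx (dx \<psi>))" "\<lambda>n x. C n 2 x * real n" "\<lambda>n. n - 1" "{1..N+2}"] that by simp
    also have "\<dots> = (\<Sum>n=2..N+2. C n 2 x * real n * real (n - 1) * y ^ (n - 1 - 1))"
      by (intro sum.mono_neutral_right) (auto simp: Suc_le_eq)
    also have "\<dots> = (\<Sum>n=0..N. C (n + 2) 2 x * real (n + 2) * real (n + 1) * y ^ n)"
      by (subst sum.shift_bounds_cl_nat_ivl[of _ 0 2 N, unfolded add_0]) simp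
    finally have 1: "dy (dy (dx (dx \<psi>))) x y = \<dots>" .
    have "dx (dx (dx (dx \<phi>))) x y = (\<Sum>n=1..N. (if n < 1 then 0 else E n 4 x) * y ^ n)"
      using \<phi>4[OF that] by simp
    also have "\<dots> = (\<Sum>n=0..N. (if n < 1 then 0 else E n 4 x) * y ^ n)"
      by (intro sum.mono_neutral_left) auto
    finally show ?thesis
      unfolding 1 by (simp add: sum_distrib_left flip: sum_subtractf) (simp add: algebra_simps)
  qed
  let ?F = "\<lambda>m. (- 2 / (real m * (real m - 1)) * C (m - 2) 2 x - (if m < 5 then 0 else
          1 / (real m * (real m - 1) * (real m - 2) * (real m - 3)) * E (m - 4) 4 x)) * y ^ m"
  have cancel: "(- 2 * p * q * c - e) / (p * q * r * s) = - 2 / (s * r) * c - 1 / (s * r * q * p) * e"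
    if "p > 0" "q > 0" "r > 0" "s > 0" for p q r s c e :: real
    using that by (simp add: field_simps)
  have "(- 2 * real (n + 1) * real (n + 2) * C (n + 2) 2 x - (if n < 1 then 0 else E n 4 x))
      / (real (n + 1) * real (n + 2) * real (n + 3) * real (n + 4)) * y ^ (n + 4) = ?F (n + 4)" for n
    by (subst cancel) (auto simp: add.commute)
  then show ?thesis
    by (subst Vop4_sum_powers[OF * \<open>y > 0\<close>], simp only:)
       (subst sum.shift_bounds_cl_nat_ivl[of _ 0 4 N, unfolded add_0], simp only:)
qed

text \<open>
  With \<open>P\<close> and \<open>R\<close> the sums of \<open>U m\<close> and of \<open>m U m\<close>, the particular solution has at \<open>y = h\<close> the
  value \<open>P\<close> and the \<open>y\<close>-derivative \<open>R / h\<close>. The integrand of \<open>Q\<close> is then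
  \<open>((g\<^sub>0 + g\<^sub>1) h + 2 P - R) / h\<^sup>3\<close>, which is the cubic coefficient without its summand \<open>-2 Q\<close>.
\<close>

lemma G_of_sum_powers:
  fixes h g1 :: "real \<Rightarrow> real" and g0 :: real and f :: "real \<Rightarrow> real \<Rightarrow> real"
  defines "Q \<equiv> snd (G h f g0 g1)"
  assumes h: "\<And>x. 0 < h x"
    and f: "\<And>x y. y > 0 \<Longrightarrow> (Vop ^^ 4) f x y = (\<Sum>m=4..M. U m x * (y / h x) ^ m)"
  shows "Q = 1 / (2 * I_int h 3) *
      integral {0..1} (\<lambda>x. ((g0 + g1 x) * h x + (\<Sum>m=4..M. (2 - real m) * U m x)) / h x ^ 3)"
    and "y > 0 \<Longrightarrow> fst (G h f g0 g1) x y =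
      g0 * h x * (y / h x)
      + (3 * Q - (2 * g0 + g1 x) * h x + (\<Sum>m=4..M. (real m - 3) * U m x)) * (y / h x) ^ 2
      + (- 2 * Q + (g0 + g1 x) * h x + (\<Sum>m=4..M. (2 - real m) * U m x)) * (y / h x) ^ 3
      + (\<Sum>m=4..M. U m x * (y / h x) ^ m)"
proof -
  have top: "(Vop ^^ 4) f x (h x) = (\<Sum>m=4..M. U m x)" for x
    using f[of "h x" x] h[of x] by simp
  have top_y: "vector_derivative ((Vop ^^ 4) f x) (at_left (h x)) = (\<Sum>m=4..M. real m * U m x) / h x" for x
  proof -
    have "((Vop ^^ 4) f x has_field_derivative (\<Sum>m=4..M. (U m x / h x ^ m) * real m * h x ^ (m - 1))) (at (h x))"
      using h[of x] by (intro sum_powers_has_derivative) (auto simp: f power_divide)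
    also have "(\<Sum>m=4..M. (U m x / h x ^ m) * real m * h x ^ (m - 1)) = (\<Sum>m=4..M. real m * U m x) / h x"
      unfolding sum_divide_distrib
    proof (intro sum.cong refl)
      fix m assume "m \<in> {4..M}"
      then obtain j where "m = Suc j" by (cases m) auto
      then show "(U m x / h x ^ m) * real m * h x ^ (m - 1) = real m * U m x / h x"
        using h[of x] by (simp add: field_simps)
    qed
    finally show ?thesis
      by (intro vector_derivative_within)
         (auto simp: trivial_limit_at_left_real simp flip: has_real_derivative_iff_has_vector_derivative intro: has_field_derivative_at_within)
  qed
  have lin: "(\<Sum>m=4..M. (2 - real m) * U m x) = 2 * (\<Sum>m=4..M. U m x) - (\<Sum>m=4..M. real m * U m x)"
       "(\<Sum>m=4..M. (real m - 3) * U m x) = (\<Sum>m=4..M. real m * U m x) - 3 * (\<Sum>m=4..M. U m x)" for x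
    by (simp_all add: left_diff_distrib sum_subtractf sum_distrib_left)
  have Q: "Q = 1 / (2 * I_int h 3) * integral {0..1} (\<lambda>x. 2 * (\<Sum>m=4..M. U m x) / h x ^ 3
      + (- ((\<Sum>m=4..M. real m * U m x) / h x) + g0 + g1 x) / h x ^ 2)"
    by (simp add: Q_def G_def Let_def top top_y)
  have integrand: "2 * P / h x ^ 3 + (- (R / h x) + g0 + g1 x) / h x ^ 2 = ((g0 + g1 x) * h x + (2 * P - R)) / h x ^ 3" for P R x
    using h[of x] by (simp add: field_simps eval_nat_numeral)
  show "Q = 1 / (2 * I_int h 3) *
      integral {0..1} (\<lambda>x. ((g0 + g1 x) * h x + (\<Sum>m=4..M. (2 - real m) * U m x)) / h x ^ 3)"
    unfolding Q integrand lin ..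
  show "fst (G h f g0 g1) x y =
      g0 * h x * (y / h x)
      + (3 * Q - (2 * g0 + g1 x) * h x + (\<Sum>m=4..M. (real m - 3) * U m x)) * (y / h x) ^ 2
      + (- 2 * Q + (g0 + g1 x) * h x + (\<Sum>m=4..M. (2 - real m) * U m x)) * (y / h x) ^ 3
      + (\<Sum>m=4..M. U m x * (y / h x) ^ m)" if "y > 0"
  proof -
    have "fst (G h f g0 g1) x y = (Vop ^^ 4) f x y + g0 * h x * (y / h x)
       + (3 * Q - 3 * (\<Sum>m=4..M. U m x) + (\<Sum>m=4..M. real m * U m x) / h x * h x - 2 * g0 * h x - g1 x * h x) * (y^2 / h x ^ 2)
       + (- 2 * Q + 2 * (\<Sum>m=4..M. U m x) - (\<Sum>m=4..M. real m * U m x) / h x * h x + g0 * h x + g1 x * h x) * (y^3 / h x ^ 3)"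
      by (simp add: Q_def G_def Let_def top top_y)
    then show ?thesis
      unfolding lin f[OF that] using h[of x] by (simp add: power_divide algebra_simps)
  qed
qed

section \<open>The three kinds of boundary data\<close>

lemma of_rat_gbinomial: "(of_rat (a gchoose k) :: real) = of_rat a gchoose k"
proof (induction k)
  case (Suc k)
  have "of_nat (Suc k) * (a gchoose Suc k) = (a - of_nat k) * (a gchoose k)"
    using gbinomial_mult_1[of a k] by (simp add: algebra_simps)
  from arg_cong[OF this, of "of_rat :: rat \<Rightarrow> real"]
  have "of_nat (Suc k) * of_rat (a gchoose Suc k) = (of_rat a - of_nat k) * (of_rat a gchoose k :: real)"
    by (simp only: of_rat_mult of_rat_diff of_rat_of_nat_eq Suc.IH)
  also have "\<dots> = of_nat (Suc k) * (of_rat a gchoose Suc k)"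
    using gbinomial_mult_1[of "of_rat a :: real" k] by (simp add: algebra_simps)
  finally show ?case by (simp del: of_nat_Suc)
qed simp

text \<open>
  Contributions to the coefficients of index 1, 2, 3 by \<open>g\<^sub>0 = V\<^sub>0\<close> (divided by \<open>V\<^sub>0 h\<close>), by
  \<open>g\<^sub>1\<close> (divided by \<open>V\<^sub>1 h\<close>) and by \<open>Q\<close> (divided by \<open>Q\<close>). They are read off from the definition
  of \<open>G\<close>.
\<close>

definition source0 :: "nat \<Rightarrow> nat \<Rightarrow> diff_poly" where
  "source0 k n = Poly_Mapping.single 0
     (if k = 0 then if n = 1 then 1 else if n = 2 then - 2 else if n = 3 then 1 else 0 else 0)"

definition source1 :: "nat \<Rightarrow> nat \<Rightarrow> diff_poly" where
  "source1 k n = Poly_Mapping.single 0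
     (((- 1 / 2) gchoose k) * (if n = 2 then - 1 else if n = 3 then 1 else 0)) * hvar 1 ^ (2 * k)"

definition sourceQ :: "nat \<Rightarrow> nat \<Rightarrow> diff_poly" where
  "sourceQ k n = Poly_Mapping.single 0
     (if k = 0 then if n = 2 then 3 else if n = 3 then - 2 else 0 else 0)"

lemma H_hom_source0: "source0 k n \<in> H_hom (2 * k)"
  using H_hom_const by (cases k) (auto simp: source0_def)

lemma H_hom_source1: "source1 k n \<in> H_hom (2 * k)"
  unfolding source1_def by (intro H_hom_scale H_hom_h1_power)

lemma H_hom_sourceQ: "sourceQ k n \<in> H_hom (2 * k)"
  using H_hom_const by (cases k) (auto simp: sourceQ_def)

text \<open>
  The coefficients with the index of the level lowered by one, and 0 in place of the level -1.
  Together with \<open>psi_prev\<close> this makes the first step of the recursion an instance of the general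
  one.
\<close>

definition coef_prev :: "nat \<Rightarrow> (nat \<Rightarrow> nat \<Rightarrow> diff_poly) \<Rightarrow> nat \<Rightarrow> nat \<Rightarrow> diff_poly" where
  "coef_prev e s k = (case k of 0 \<Rightarrow> (\<lambda>_. 0) | Suc j \<Rightarrow> coef e s j)"

lemma coef_interior:
  "4 \<le> m \<Longrightarrow> coef e s (Suc k) m = interior_coef e (coef e s k) (coef_prev e s k) m"
  by (simp add: with_boundary_def coef_prev_def)

text \<open>
  The upper limit of the sums may be any \<open>2 k + 3\<close> with \<open>k \<ge> j\<close>, as higher coefficients vanish.
  A common limit is needed when the solutions of levels \<open>k - l\<close> are superposed.
\<close>

lemma subst_coef_boundary:
  assumes "j \<le> k"
  shows "subst_poly h (coef e s j 1) x = subst_poly h (s j 1) x"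
    and "subst_poly h (coef e s j 2) x =
      subst_poly h (s j 2) x + (\<Sum>m=4..2*k+3. (real m - 3) * subst_poly h (coef e s j m) x)"
    and "subst_poly h (coef e s j 3) x =
      subst_poly h (s j 3) x + (\<Sum>m=4..2*k+3. (2 - real m) * subst_poly h (coef e s j m) x)"
proof -
  obtain r where r: "\<And>n. coef e s j n = with_boundary (s j) (2 * j + 3) r n"
  proof (cases j)
    case 0
    then show ?thesis using that by simp
  next
    case (Suc i)
    then show ?thesis using that by (simp add: numeral_eq_Suc)
  qed
  have ext: "(\<Sum>m=4..2*j+3. a m * subst_poly h (r m) x) = (\<Sum>m=4..2*k+3. a m * subst_poly h (coef e s j m) x)" for a :: "nat \<Rightarrow> real"
  proof -
    have "(\<Sum>m=4..2*j+3. a m * subst_poly h (r m) x) = (\<Sum>m=4..2*j+3. a m * subst_poly h (coef e s j m) x)"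
      by (intro sum.cong refl) (simp add: r with_boundary_def)
    also have "\<dots> = (\<Sum>m=4..2*k+3. a m * subst_poly h (coef e s j m) x)"
      using assms by (intro sum.mono_neutral_left) (auto simp: coef_eq_0 simp del: coef.simps)
    finally show ?thesis .
  qed
  show "subst_poly h (coef e s j 1) x = subst_poly h (s j 1) x"
    by (simp add: r with_boundary_def)
  show "subst_poly h (coef e s j 2) x =
      subst_poly h (s j 2) x + (\<Sum>m=4..2*k+3. (real m - 3) * subst_poly h (coef e s j m) x)"
    unfolding ext[symmetric] by (simp add: r with_boundary_def of_rat_diff)
  show "subst_poly h (coef e s j 3) x =
      subst_poly h (s j 3) x + (\<Sum>m=4..2*k+3. (2 - real m) * subst_poly h (coef e s j m) x)"
    unfolding ext[symmetric] by (simp add: r with_boundary_def of_rat_diff)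
qed

definition psi_prev :: "(real \<Rightarrow> real) \<Rightarrow> real \<Rightarrow> real \<Rightarrow> nat \<Rightarrow> real \<Rightarrow> real \<Rightarrow> real" where
  "psi_prev h V0 V1 k = (case k of 0 \<Rightarrow> (\<lambda>_ _. 0) | Suc j \<Rightarrow> psi_term h V0 V1 j)"

lemma dx_zero: "dx (\<lambda>_ _. 0) = (\<lambda>_ _. 0)"
  by (simp add: dx_def fun_eq_iff)

lemma expansion_Suc:
  "expansion h V0 V1 (Suc k) =
     G h (\<lambda>x y. - 2 * dy (dy (dx (dx (psi_term h V0 V1 k)))) x y - dx (dx (dx (dx (psi_prev h V0 V1 k)))) x y)
       0 (g1_term h V1 (Suc k))"
  by (cases k) (simp_all add: psi_term_def psi_prev_def dx_zero)

section \<open>The expansion for a fixed profile \<open>h\<close>\<close>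

text \<open>
  The regularity is the one needed for level \<open>K\<close>; it is kept fixed while the induction runs
  through the levels up to \<open>K\<close>.
\<close>

locale profile =
  fixes h :: "real \<Rightarrow> real" and V0 V1 :: real and K :: nat
  assumes regular: "C_periodic (2 * K) h" and pos: "\<And>x. 0 < h x"
begin

lemma differentiable: "j < 2 * K \<Longrightarrow> (deriv ^^ j) h field_differentiable at x"
  using regular by (simp add: C_periodic_def)

lemma continuous: "j \<le> 2 * K \<Longrightarrow> continuous_on S ((deriv ^^ j) h)"
proof (cases "j = 2 * K")
  case True
  then show ?thesis using regular continuous_on_subset by (auto simp: C_periodic_def)
next
  case False
  assume "j \<le> 2 * K"
  with False differentiable[of j] show ?thesis
    by (intro continuous_at_imp_continuous_on ballI field_differentiable_imp_continuous_at) simp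
qed

lemma continuous_h: "continuous_on S h"
  using continuous[of 0] by simp

lemma I_int_pos: "0 < I_int h m"
proof -
  let ?f = "\<lambda>x. 1 / h x ^ m"
  have c: "continuous_on {0..1} ?f"
    using pos by (intro continuous_intros continuous_h) (simp add: less_imp_neq[symmetric])
  have "I_int h m \<ge> 0"
    unfolding I_int_def using pos by (intro integral_nonneg integrable_continuous_interval c) (simp add: less_imp_le)
  moreover have "I_int h m \<noteq> 0"
    unfolding I_int_def using integral_eq_0_iff[OF c] pos by (auto simp: less_imp_le less_imp_neq[symmetric])
  ultimately show ?thesis by simp
qed

abbreviation "Q \<equiv> Q_term h V0 V1"
abbreviation "\<psi> \<equiv> psi_term h V0 V1"

text \<open>
  The \<open>i\<close>-th \<open>x\<close>-derivative of the coefficient of \<open>y\<^sup>n\<close> in the sum of \<open>h\<^sup>e c\<^sub>n (y/h)\<^sup>n\<close>. This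
  reading needs \<open>e \<le> n\<close>, which holds for \<open>e \<le> 1 \<le> n\<close>.
\<close>

definition W :: "nat \<Rightarrow> (nat \<Rightarrow> diff_poly) \<Rightarrow> nat \<Rightarrow> nat \<Rightarrow> real \<Rightarrow> real" where
  "W e c n i x = subst_poly h (weighted_Ds (n - e) i (c n)) x / h x ^ (n - e + i)"

lemma W_zero [simp]: "W e (\<lambda>_. 0) n i x = 0"
  by (simp add: W_def)

lemma W_derivative:
  assumes "c n \<in> H_hom (2 * k)" "2 * k + i < 2 * K"
  shows "(W e c n i has_field_derivative W e c n (Suc i) x) (at x)"
  unfolding W_def[abs_def]
  using assms differentiable pos[of x]
  by (intro weighted_iterated_derivative) auto

lemma W_interior:
  assumes "4 \<le> m" "e \<le> 1"
  shows "h x ^ e * subst_poly h (interior_coef e p q m) x / h x ^ m =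
    - 2 / (real m * (real m - 1)) * W e p (m - 2) 2 x
    - (if m < 5 then 0 else
       1 / (real m * (real m - 1) * (real m - 2) * (real m - 3)) * W e q (m - 4) 4 x)"
proof -
  have h: "h x \<noteq> 0" using pos[of x] by simp
  have quot: "h x ^ e * y / h x ^ m = y / h x ^ (m - e)" for y
    using assms h by (simp add: power_diff)
  have ix: "m - 2 - e + 2 = m - e" "m \<ge> 5 \<Longrightarrow> m - (4 + e) + 4 = m - e"
    using assms by auto
  show ?thesis
    unfolding quot W_def ix(1)
    by (cases "m < 5") (simp_all add: ix(2) interior_coef_def diff_divide_distrib of_rat_mult of_rat_divide of_rat_diff of_rat_minus)
qed

text \<open>
  The superposition of the three kinds of solutions; \<open>c\<close> is \<open>coef\<close> or \<open>coef_prev\<close>. The result is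
  the \<open>i\<close>-th \<open>x\<close>-derivative of the coefficient of \<open>y\<^sup>n\<close> in \<open>\<psi>\<close> at level \<open>k\<close> or \<open>k - 1\<close>.
\<close>

definition combine :: "(nat \<Rightarrow> (nat \<Rightarrow> nat \<Rightarrow> diff_poly) \<Rightarrow> nat \<Rightarrow> nat \<Rightarrow> diff_poly) \<Rightarrow> nat \<Rightarrow> nat \<Rightarrow> nat \<Rightarrow> real \<Rightarrow> real" where
  "combine c k n i x = V0 * W 1 (c 1 source0 k) n i x + V1 * W 1 (c 1 source1 k) n i x
     + (\<Sum>l\<le>k. Q l * W 0 (c 0 sourceQ (k - l)) n i x)"

text \<open>
  The coefficient of \<open>(y/h)\<^sup>n\<close> in \<open>\<psi>\<close> at level \<open>k\<close>, as a superposition.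
\<close>

definition psi_coef :: "nat \<Rightarrow> nat \<Rightarrow> real \<Rightarrow> real" where
  "psi_coef k n x = V0 * (h x * subst_poly h (coef 1 source0 k n) x) + V1 * (h x * subst_poly h (coef 1 source1 k n) x)
     + (\<Sum>l\<le>k. Q l * subst_poly h (coef 0 sourceQ (k - l) n) x)"

lemma combine_coef_0: "1 \<le> n \<Longrightarrow> combine coef k n 0 x = psi_coef k n x / h x ^ n"
proof -
  assume "1 \<le> n"
  then obtain j where "n = Suc j" by (cases n) auto
  then show ?thesis
    using pos[of x] by (simp add: combine_def psi_coef_def W_def add_divide_distrib sum_divide_distrib)
qed

lemma combine_derivative:
  assumes "2 * k + i < 2 * K"
  shows "(combine coef k n i has_field_derivative combine coef k n (Suc i) x) (at x)"
proof -
  have "(W 0 (coef 0 sourceQ (k - l)) n i has_field_derivative W 0 (coef 0 sourceQ (k - l)) n (Suc i) x) (at x)"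
    if "l \<le> k" for l
    using assms by (intro W_derivative[of _ _ "k - l"] H_hom_coef H_hom_sourceQ) auto
  moreover have "(W 1 (coef 1 s k) n i has_field_derivative W 1 (coef 1 s k) n (Suc i) x) (at x)"
    if "\<And>k n. s k n \<in> H_hom (2 * k)" for s
    using assms that by (intro W_derivative[of _ _ k] H_hom_coef) auto
  ultimately show ?thesis
    unfolding combine_def[abs_def]
    by (intro DERIV_add DERIV_sum DERIV_cmult) (auto simp: H_hom_source0 H_hom_source1)
qed

lemma combine_prev_0: "combine coef_prev 0 n i x = 0"
  by (simp add: combine_def coef_prev_def)

text \<open>
  Shifting the level removes the summand \<open>l = k + 1\<close>, since \<open>coef_prev\<close> vanishes at level 0. So
  the superposition has the right form for both earlier terms of the recursion.
\<close>

lemma combine_prev_Suc: "combine coef_prev (Suc k) n i x = combine coef k n i x"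
proof -
  have "(\<Sum>l\<le>Suc k. Q l * W 0 (coef_prev 0 sourceQ (Suc k - l)) n i x)
      = (\<Sum>l\<le>k. Q l * W 0 (coef_prev 0 sourceQ (Suc k - l)) n i x)"
    by (simp add: coef_prev_def)
  also have "\<dots> = (\<Sum>l\<le>k. Q l * W 0 (coef 0 sourceQ (k - l)) n i x)"
    by (intro sum.cong refl) (simp add: coef_prev_def Suc_diff_le del: coef.simps)
  finally show ?thesis
    by (simp add: combine_def coef_prev_def del: coef.simps)
qed

text \<open>
  The superposed coefficients satisfy the interior part of the recursion. The summand
  \<open>l = k + 1\<close> on the left, which has no counterpart on the right, is a multiple of
  \<open>coef 0 sourceQ 0 m\<close> and vanishes for \<open>m \<ge> 4\<close>.
\<close>

lemma psi_coef_interior: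
  assumes "4 \<le> m"
  shows "psi_coef (Suc k) m x / h x ^ m =
    - 2 / (real m * (real m - 1)) * combine coef k (m - 2) 2 x
    - (if m < 5 then 0 else
       1 / (real m * (real m - 1) * (real m - 2) * (real m - 3)) * combine coef_prev k (m - 4) 4 x)"
proof -
  let ?a = "- 2 / (real m * (real m - 1))"
  let ?b = "if m < 5 then 0 else 1 / (real m * (real m - 1) * (real m - 2) * (real m - 3))"
  have I: "h x ^ e * subst_poly h (coef e s (Suc j) m) x / h x ^ m =
      ?a * W e (coef e s j) (m - 2) 2 x - ?b * W e (coef_prev e s j) (m - 4) 4 x" if "e \<le> 1" for e s j
    using W_interior[OF assms that] by (simp add: coef_interior assms del: coef.simps)
  have "coef 0 sourceQ 0 m = 0"
    using assms by (intro coef_eq_0) simp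
  then have "(\<Sum>l\<le>Suc k. Q l * subst_poly h (coef 0 sourceQ (Suc k - l) m) x / h x ^ m) =
      (\<Sum>l\<le>k. Q l * (subst_poly h (coef 0 sourceQ (Suc (k - l)) m) x / h x ^ m))"
    by (simp add: Suc_diff_le del: coef.simps)
  also have "\<dots> = (\<Sum>l\<le>k. Q l * (?a * W 0 (coef 0 sourceQ (k - l)) (m - 2) 2 x
      - ?b * W 0 (coef_prev 0 sourceQ (k - l)) (m - 4) 4 x))"
    using I[of 0] by (simp del: coef.simps)
  also have "\<dots> = ?a * (\<Sum>l\<le>k. Q l * W 0 (coef 0 sourceQ (k - l)) (m - 2) 2 x)
      - ?b * (\<Sum>l\<le>k. Q l * W 0 (coef_prev 0 sourceQ (k - l)) (m - 4) 4 x)"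
    by (simp add: right_diff_distrib sum_subtractf sum_distrib_left mult.left_commute)
  finally have sumQ: "(\<Sum>l\<le>Suc k. Q l * subst_poly h (coef 0 sourceQ (Suc k - l) m) x / h x ^ m) = \<dots>" .
  have "psi_coef (Suc k) m x / h x ^ m =
      V0 * (h x ^ 1 * subst_poly h (coef 1 source0 (Suc k) m) x / h x ^ m)
      + V1 * (h x ^ 1 * subst_poly h (coef 1 source1 (Suc k) m) x / h x ^ m)
      + (\<Sum>l\<le>Suc k. Q l * subst_poly h (coef 0 sourceQ (Suc k - l) m) x / h x ^ m)"
    by (simp only: psi_coef_def add_divide_distrib sum_divide_distrib power_one_right times_divide_eq_right)
  also have "\<dots> = ?a * combine coef k (m - 2) 2 x - ?b * combine coef_prev k (m - 4) 4 x"
    unfolding sumQ I[OF order.refl] combine_def by (simp only: algebra_simps)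
  finally show ?thesis by simp
qed

text \<open>
  Among the summands of the superposition, only \<open>l = k\<close> has a \<open>Q\<close>-source at level 0; this is how
  \<open>Q k\<close> enters with the factors 3 and -2.
\<close>

lemma psi_coef_boundary:
  fixes k x
  defines "g0 \<equiv> if k = 0 then V0 else 0" and "g1 \<equiv> g1_term h V1 k x"
  shows "psi_coef k 1 x = g0 * h x"
    and "psi_coef k 2 x = 3 * Q k - (2 * g0 + g1) * h x + (\<Sum>m=4..2*k+3. (real m - 3) * psi_coef k m x)"
    and "psi_coef k 3 x = - 2 * Q k + (g0 + g1) * h x + (\<Sum>m=4..2*k+3. (2 - real m) * psi_coef k m x)"
proof -
  have Q_part: "(\<Sum>l\<le>k. Q l * subst_poly h (sourceQ (k - l) n) x) = Q k * of_rat (if n = 2 then 3 else if n = 3 then - 2 else 0)" for n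
  proof -
    have "(\<Sum>l\<le>k. Q l * subst_poly h (sourceQ (k - l) n) x) = (\<Sum>l\<in>{k}. Q l * subst_poly h (sourceQ (k - l) n) x)"
      by (intro sum.mono_neutral_right) (auto simp: sourceQ_def)
    then show ?thesis by (simp add: sourceQ_def)
  qed
  have g1: "V1 * subst_poly h (source1 k n) x = g1 * of_rat (if n = 2 then - 1 else if n = 3 then 1 else 0)" for n
    by (simp add: source1_def g1_def g1_term_def of_rat_mult of_rat_gbinomial of_rat_divide of_rat_minus)
  have g0: "V0 * subst_poly h (source0 k n) x = g0 * of_rat (if n = 1 then 1 else if n = 2 then - 2 else if n = 3 then 1 else 0)" for n
    by (simp add: source0_def g0_def)
  have lin: "(\<Sum>m=4..2*k+3. a m * psi_coef k m x) =
      h x * V0 * (\<Sum>m=4..2*k+3. a m * subst_poly h (coef 1 source0 k m) x)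
      + h x * V1 * (\<Sum>m=4..2*k+3. a m * subst_poly h (coef 1 source1 k m) x)
      + (\<Sum>l\<le>k. Q l * (\<Sum>m=4..2*k+3. a m * subst_poly h (coef 0 sourceQ (k - l) m) x))" for a :: "nat \<Rightarrow> real"
    unfolding psi_coef_def sum_distrib_left
    by (subst sum.swap[where A = "{..k}"]) (simp add: distrib_left sum.distrib sum_distrib_left mult_ac del: coef.simps)
  have reduce: "psi_coef k n x = h x * (V0 * subst_poly h (source0 k n) x) + h x * (V1 * subst_poly h (source1 k n) x)
      + (\<Sum>l\<le>k. Q l * subst_poly h (sourceQ (k - l) n) x) + (\<Sum>m=4..2*k+3. a m * psi_coef k m x)"
    if "\<And>e s j. j \<le> k \<Longrightarrow> subst_poly h (coef e s j n) x =
      subst_poly h (s j n) x + (\<Sum>m=4..2*k+3. a m * subst_poly h (coef e s j m) x)" for n and a :: "nat \<Rightarrow> real"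
    unfolding lin unfolding psi_coef_def
    by (simp add: that distrib_left sum.distrib mult_ac del: coef.simps)
  show "psi_coef k 1 x = g0 * h x"
    using reduce[of 1 "\<lambda>_. 0"] subst_coef_boundary(1)[of _ k] Q_part[of 1] g0[of 1] g1[of 1] by simp
  show "psi_coef k 2 x = 3 * Q k - (2 * g0 + g1) * h x + (\<Sum>m=4..2*k+3. (real m - 3) * psi_coef k m x)"
    using reduce[of 2 "\<lambda>m. real m - 3"] subst_coef_boundary(2)[of _ k] Q_part[of 2] g0[of 2] g1[of 2]
    by (simp add: algebra_simps of_rat_minus)
  show "psi_coef k 3 x = - 2 * Q k + (g0 + g1) * h x + (\<Sum>m=4..2*k+3. (2 - real m) * psi_coef k m x)"
    using reduce[of 3 "\<lambda>m. 2 - real m"] subst_coef_boundary(3)[of _ k] Q_part[of 3] g0[of 3] g1[of 3]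
    by (simp add: algebra_simps of_rat_minus)
qed


lemma psi_Q_of_interior:
  assumes G: "expansion h V0 V1 k = G h f (if k = 0 then V0 else 0) (g1_term h V1 k)"
    and f: "\<And>x y. y > 0 \<Longrightarrow> (Vop ^^ 4) f x y = (\<Sum>m=4..2*k+3. psi_coef k m x * (y / h x) ^ m)"
  shows "Q k = 1 / (2 * I_int h 3) * integral {0..1} (\<lambda>x. (psi_coef k 3 x + 2 * Q k) / h x ^ 3)"
    and "y > 0 \<Longrightarrow> \<psi> k x y = (\<Sum>n=1..2*k+3. psi_coef k n x * (y / h x) ^ n)"
proof -
  have Q: "snd (G h f (if k = 0 then V0 else 0) (g1_term h V1 k)) = Q k"
    by (simp add: Q_term_def G)
  show "Q k = 1 / (2 * I_int h 3) * integral {0..1} (\<lambda>x. (psi_coef k 3 x + 2 * Q k) / h x ^ 3)"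
    using G_of_sum_powers(1)[OF pos f, where ?g0.0 = "if k = 0 then V0 else 0" and ?g1.0 = "g1_term h V1 k", unfolded Q]
    by (simp add: psi_coef_boundary(3))
  assume "y > 0"
  have "{1..2*k+3} = {1, 2, 3} \<union> {4..2*k+3}" by auto
  then have split: "(\<Sum>n=1..2*k+3. psi_coef k n x * (y / h x) ^ n) =
      psi_coef k 1 x * (y / h x) + psi_coef k 2 x * (y / h x) ^ 2 + psi_coef k 3 x * (y / h x) ^ 3
      + (\<Sum>n=4..2*k+3. psi_coef k n x * (y / h x) ^ n)"
    by (simp add: sum.union_disjoint)
  have "\<psi> k x y = fst (G h f (if k = 0 then V0 else 0) (g1_term h V1 k)) x y"
    by (simp add: psi_term_def G)
  then show "\<psi> k x y = (\<Sum>n=1..2*k+3. psi_coef k n x * (y / h x) ^ n)"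
    unfolding split psi_coef_boundary(1) psi_coef_boundary(2)[of k] psi_coef_boundary(3)[of k]
    using G_of_sum_powers(2)[OF pos f \<open>y > 0\<close>, where ?g0.0 = "if k = 0 then V0 else 0" and ?g1.0 = "g1_term h V1 k", unfolded Q]
    by simp
qed

text \<open>
  The induction. The number \<open>Q k\<close> occurs in the superposition at level \<open>k\<close>, so the fourfold
  integral of the source is expanded first: this uses only earlier levels, and then
  \<open>psi_Q_of_interior\<close> gives \<open>\<psi> k\<close> and \<open>Q k\<close>. Differentiability suffices because the coefficients
  at level \<open>j\<close> have superdegree \<open>2 j\<close> and are differentiated twice for level \<open>j + 1\<close> and four
  times for level \<open>j + 2\<close>.
\<close>

lemma interior_expansion:
  assumes "k \<le> K"
  obtains f where "expansion h V0 V1 k = G h f (if k = 0 then V0 else 0) (g1_term h V1 k)"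
    and "\<And>x y. y > 0 \<Longrightarrow> (Vop ^^ 4) f x y = (\<Sum>m=4..2*k+3. psi_coef k m x * (y / h x) ^ m)"
  using assms
proof (induction k arbitrary: thesis rule: less_induct)
  case (less k)
  show ?case
  proof (cases k)
    case 0
    show ?thesis
      using Vop4_sum_powers[where f = "\<lambda>_ _. 0" and S = "{}" and C = "\<lambda>_ _. 0"] by (intro less.prems(1)[of "\<lambda>_ _. 0"]) (simp_all add: 0)
  next
    case (Suc j)
    have psi: "\<psi> i x y = (\<Sum>n=1..2*i+3. combine coef i n 0 x * y ^ n)" if "i < k" "y > 0" for i x y
    proof -
      obtain f where "expansion h V0 V1 i = G h f (if i = 0 then V0 else 0) (g1_term h V1 i)"
        and "\<And>x y. y > 0 \<Longrightarrow> (Vop ^^ 4) f x y = (\<Sum>m=4..2*i+3. psi_coef i m x * (y / h x) ^ m)"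
        using less.IH[OF \<open>i < k\<close>] less.prems(2) \<open>i < k\<close> by auto
      from psi_Q_of_interior(2)[OF this \<open>y > 0\<close>] show ?thesis
        by (simp add: combine_coef_0 power_divide)
    qed
    have psi_j: "\<psi> j x y = (\<Sum>n=1..(2*j+1)+2. combine coef j n 0 x * y ^ n)" if "y > 0" for x y
      using psi[of j y x] that Suc by (simp add: eval_nat_numeral)
    have psi_prev: "psi_prev h V0 V1 j x y = (\<Sum>n=1..2*j+1. combine coef_prev j n 0 x * y ^ n)" if "y > 0" for x y
      using psi[of "j - 1" y x] that Suc
      by (cases j) (simp_all add: psi_prev_def combine_prev_0 combine_prev_Suc eval_nat_numeral)
    have d: "(combine coef j n i has_field_derivative combine coef j n (Suc i) x) (at x)" if "i < 2" for n i x
      using that less.prems(2) Suc by (intro combine_derivative) auto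
    have d_prev: "(combine coef_prev j n i has_field_derivative combine coef_prev j n (Suc i) x) (at x)" if "i < 4" for n i x
    proof (cases j)
      case 0
      then show ?thesis using combine_prev_0 by (simp add: ext[of "combine coef_prev 0 n i" "\<lambda>_. 0"])
    next
      case (Suc l)
      then show ?thesis
        using that less.prems(2) \<open>k = Suc j\<close> combine_derivative[of l i n x]
        by (simp add: combine_prev_Suc[abs_def] ext[of "combine coef_prev (Suc l) n i" "combine coef l n i"])
    qed
    show ?thesis
    proof (rule less.prems(1))
      show "expansion h V0 V1 k = G h (\<lambda>x y. - 2 * dy (dy (dx (dx (\<psi> j)))) x y
          - dx (dx (dx (dx (psi_prev h V0 V1 j)))) x y) (if k = 0 then V0 else 0) (g1_term h V1 k)"
        unfolding Suc by (subst expansion_Suc) simp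
      fix x y :: real assume "y > 0"
      have "(Vop ^^ 4) (\<lambda>x y. - 2 * dy (dy (dx (dx (\<psi> j)))) x y - dx (dx (dx (dx (psi_prev h V0 V1 j)))) x y) x y
          = (\<Sum>m=4..(2*j+1)+4. psi_coef (Suc j) m x / h x ^ m * y ^ m)"
        by (subst Vop4_source[OF psi_j psi_prev d d_prev \<open>y > 0\<close>]) (auto simp: psi_coef_interior)
      then show "(Vop ^^ 4) (\<lambda>x y. - 2 * dy (dy (dx (dx (\<psi> j)))) x y - dx (dx (dx (dx (psi_prev h V0 V1 j)))) x y) x y
          = (\<Sum>m=4..2*k+3. psi_coef k m x * (y / h x) ^ m)"
        by (simp add: Suc power_divide eval_nat_numeral)
    qed
  qed
qed

lemma psi_eq:
  assumes "k \<le> K" "y > 0"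
  shows "\<psi> k x y = (\<Sum>n=1..2*k+3. psi_coef k n x * (y / h x) ^ n)"
  by (rule interior_expansion[OF assms(1)]) (rule psi_Q_of_interior(2)[OF _ _ assms(2)])

lemma Q_eq:
  assumes "k \<le> K"
  shows "Q k = 1 / (2 * I_int h 3) * integral {0..1} (\<lambda>x. (psi_coef k 3 x + 2 * Q k) / h x ^ 3)"
  by (rule interior_expansion[OF assms]) (rule psi_Q_of_interior(1))

definition alpha_coef :: "nat \<Rightarrow> nat \<Rightarrow> real \<Rightarrow> real" where
  "alpha_coef k n x = h x * (V0 * subst_poly h (coef 1 source0 k n) x + V1 * subst_poly h (coef 1 source1 k n) x)"

definition beta_coef :: "nat \<Rightarrow> nat \<Rightarrow> real \<Rightarrow> real" where
  "beta_coef k n x = subst_poly h (coef 0 sourceQ k n) x"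

lemma psi_coef_split: "psi_coef k n x = alpha_coef k n x + (\<Sum>l\<le>k. Q l * beta_coef (k - l) n x)"
  by (simp add: psi_coef_def alpha_coef_def beta_coef_def algebra_simps)

lemma psi_decomposition:
  assumes "k \<le> K" "y > 0"
  shows "\<psi> k x y = (\<Sum>n=1..2*k+3. alpha_coef k n x * (y ^ n / h x ^ n))
    + (\<Sum>l\<le>k. Q l * (\<Sum>n=1..2*(k-l)+3. beta_coef (k - l) n x * (y ^ n / h x ^ n)))"
proof -
  have ext: "(\<Sum>n=1..2*(k-l)+3. beta_coef (k - l) n x * (y ^ n / h x ^ n)) = (\<Sum>n=1..2*k+3. beta_coef (k - l) n x * (y ^ n / h x ^ n))" for l
    by (intro sum.mono_neutral_left) (auto simp: beta_coef_def coef_eq_0 simp del: coef.simps)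
  show ?thesis
    unfolding psi_eq[OF assms] psi_coef_split ext sum_distrib_left
    by (subst sum.swap[where A = "{..k}"]) (simp add: power_divide distrib_right sum.distrib sum_distrib_right add_divide_distrib sum_divide_distrib mult.assoc)
qed

lemma continuous_coef:
  assumes "\<And>k n. s k n \<in> H_hom (2 * k)" "k \<le> K"
  shows "continuous_on S (subst_poly h (coef e s k n))"
  using H_hom_coef[OF assms(1), where e = e and k = k and n = n] assms(2)
  by (intro continuous_on_subst_poly[where k = "2 * k"] continuous) (auto simp: H_hom_iff)

text \<open>
  The summand \<open>l = k\<close> of the cubic coefficient is \<open>-2 Q k\<close> and cancels the term \<open>2 Q k\<close> in the
  integrand.
\<close>

lemma Q_decomposition:
  assumes "k \<le> K"
  shows "Q k = 1 / (2 * I_int h 3) * integral {0..1} (\<lambda>x. alpha_coef k 3 x / h x ^ 3)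
    + (\<Sum>l<k. Q l * (1 / (2 * I_int h 3) * integral {0..1} (\<lambda>x. beta_coef (k - l) 3 x / h x ^ 3)))"
proof -
  have h3: "h x ^ 3 \<noteq> 0" for x using pos[of x] by simp
  have "coef 0 sourceQ 0 3 = Poly_Mapping.single 0 (- 2)"
    by (simp add: with_boundary_def sourceQ_def)
  then have "beta_coef 0 3 x = - 2" for x
    by (simp add: beta_coef_def of_rat_minus del: coef.simps)
  then have integrand: "(psi_coef k 3 x + 2 * Q k) / h x ^ 3 = alpha_coef k 3 x / h x ^ 3 + (\<Sum>l<k. Q l * (beta_coef (k - l) 3 x / h x ^ 3))" for x
    by (simp add: psi_coef_split add_divide_distrib sum_divide_distrib flip: lessThan_Suc_atMost)
  have "continuous_on {0..1} (\<lambda>x. alpha_coef k 3 x / h x ^ 3)"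
    unfolding alpha_coef_def using h3 assms
    by (intro continuous_intros continuous_coef continuous_h H_hom_source0 H_hom_source1) auto
  moreover have "continuous_on {0..1} (\<lambda>x. beta_coef (k - l) 3 x / h x ^ 3)" for l
    unfolding beta_coef_def using h3 assms
    by (intro continuous_intros continuous_coef continuous_h H_hom_sourceQ) auto
  ultimately have int: "(\<lambda>x. alpha_coef k 3 x / h x ^ 3) integrable_on {0..1}"
      "\<And>l. (\<lambda>x. beta_coef (k - l) 3 x / h x ^ 3) integrable_on {0..1}"
    by (auto intro: integrable_continuous_interval)
  have "integral {0..1} (\<lambda>x. \<Sum>l<k. Q l * (beta_coef (k - l) 3 x / h x ^ 3)) =
      (\<Sum>l<k. integral {0..1} (\<lambda>x. Q l * (beta_coef (k - l) 3 x / h x ^ 3)))"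
    by (intro integral_sum integrable_on_mult_right int) simp
  then have "integral {0..1} (\<lambda>x. (psi_coef k 3 x + 2 * Q k) / h x ^ 3) =
      integral {0..1} (\<lambda>x. alpha_coef k 3 x / h x ^ 3) + (\<Sum>l<k. Q l * integral {0..1} (\<lambda>x. beta_coef (k - l) 3 x / h x ^ 3))"
    unfolding integrand
    by (subst integral_add) (auto simp del: times_divide_eq_right intro!: int integrable_sum integrable_on_mult_right)
  then show ?thesis
    by (subst Q_eq[OF assms]) (simp add: distrib_left sum_distrib_left mult_ac)
qed

end

theorem theorem3p3:
  shows "\<exists>(A :: nat \<Rightarrow> nat \<Rightarrow> diff_poly \<times> diff_poly) (B :: nat \<Rightarrow> nat \<Rightarrow> diff_poly).
    (\<forall>k. \<forall>n\<in>{1..2*k+3}. A k n \<in> VH (2*k) \<and> B k n \<in> H_hom (2*k)) \<and>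
    (\<forall>(k::nat) (h::real \<Rightarrow> real) (V0::real) (V1::real).
      C_periodic (2*k) h \<longrightarrow> (\<forall>x. 0 < h x) \<longrightarrow>
      (let I2 = I_int h 2; I3 = I_int h 3;
           Q = Q_term h V0 V1; \<psi> = psi_term h V0 V1;
           \<alpha>c = (\<lambda>j n x. I3 / I2 * h x * subst_VH h V0 V1 (A j n) x);
           \<beta>c = (\<lambda>j n x. subst_poly h (B j n) x);
           \<alpha> = (\<lambda>j x y. \<Sum>n=1..2*j+3. \<alpha>c j n x * (y^n / h x ^ n));
           \<beta> = (\<lambda>j x y. \<Sum>n=1..2*j+3. \<beta>c j n x * (y^n / h x ^ n));
           a = (\<lambda>j. 1 / (2 * I3) * integral {0..1} (\<lambda>x. \<alpha>c j 3 x / h x ^ 3));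
           b = (\<lambda>j. 1 / (2 * I3) * integral {0..1} (\<lambda>x. \<beta>c j 3 x / h x ^ 3))
       in Q k = I2 / I3 * a k + (\<Sum>l<k. Q l * b (k - l)) \<and>
          (\<forall>(x, y)\<in>Omega h. \<psi> k x y = I2 / I3 * \<alpha> k x y + (\<Sum>l\<le>k. Q l * \<beta> (k - l) x y))))"
proof -
  define A :: "nat \<Rightarrow> nat \<Rightarrow> diff_poly \<times> diff_poly" where "A = (\<lambda>k n. (coef 1 source0 k n, coef 1 source1 k n))"
  define B :: "nat \<Rightarrow> nat \<Rightarrow> diff_poly" where "B = coef 0 sourceQ"
  have mem: "A k n \<in> VH (2 * k) \<and> B k n \<in> H_hom (2 * k)" for k n
    by (simp add: A_def B_def VH_def H_hom_coef H_hom_source0 H_hom_source1 H_hom_sourceQ)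
  have Q_eq: "Q_term h V0 V1 k = I2 / I3 * (1 / (2 * I3) * integral {0..1} (\<lambda>x. I3 / I2 * h x * subst_VH h V0 V1 (A k 3) x / h x ^ 3))
        + (\<Sum>l<k. Q_term h V0 V1 l * (1 / (2 * I3) * integral {0..1} (\<lambda>x. subst_poly h (B (k - l) 3) x / h x ^ 3)))"
      (is ?Q)
    and psi_eq: "\<forall>(x, y)\<in>Omega h. psi_term h V0 V1 k x y =
        I2 / I3 * (\<Sum>n=1..2*k+3. I3 / I2 * h x * subst_VH h V0 V1 (A k n) x * (y ^ n / h x ^ n))
        + (\<Sum>l\<le>k. Q_term h V0 V1 l * (\<Sum>n=1..2*(k-l)+3. subst_poly h (B (k - l) n) x * (y ^ n / h x ^ n)))"
      (is ?psi)
    if "C_periodic (2 * k) h" "\<forall>x. 0 < h x" and I: "I2 = I_int h 2" "I3 = I_int h 3" for k h V0 V1 I2 I3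
  proof -
    interpret profile h V0 V1 k
      using that by unfold_locales auto
    have I_nonzero: "I2 \<noteq> 0" "I3 \<noteq> 0"
      using I_int_pos[of 2] I_int_pos[of 3] I by auto
    \<comment> \<open>the factor \<open>I3 / I2\<close> in the statement is undone by the prefactor \<open>I2 / I3\<close>\<close>
    have A: "I3 / I2 * h x * subst_VH h V0 V1 (A k n) x = I3 / I2 * alpha_coef k n x" for n x
      by (simp add: A_def alpha_coef_def subst_VH_def)
    have "integral {0..1} (\<lambda>x. I3 / I2 * alpha_coef k 3 x / h x ^ 3) = I3 / I2 * integral {0..1} (\<lambda>x. alpha_coef k 3 x / h x ^ 3)"
      using integral_mult_right[of "{0..1}" "I3 / I2" "\<lambda>x. alpha_coef k 3 x / h x ^ 3"] by simp
    then have "I2 / I3 * (1 / (2 * I3) * integral {0..1} (\<lambda>x. I3 / I2 * h x * subst_VH h V0 V1 (A k 3) x / h x ^ 3))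
        = 1 / (2 * I3) * integral {0..1} (\<lambda>x. alpha_coef k 3 x / h x ^ 3)"
      unfolding A using I_nonzero by simp
    then show ?Q
      using Q_decomposition[of k] I by (simp add: B_def beta_coef_def[abs_def])
    have "I2 / I3 * (\<Sum>n=1..2*k+3. I3 / I2 * alpha_coef k n x * (y ^ n / h x ^ n)) = (\<Sum>n=1..2*k+3. alpha_coef k n x * (y ^ n / h x ^ n))" for x y
      using I_nonzero by (simp add: sum_distrib_left)
    then show ?psi
      using psi_decomposition[of k] unfolding A by (auto simp: Omega_def B_def beta_coef_def)
  qed
  show ?thesis
    unfolding Let_def
    by (rule exI[of _ A], rule exI[of _ B], rule conjI, use mem in blast, intro allI impI, rule conjI,
        rule Q_eq[OF _ _ refl refl], assumption+, rule psi_eq[OF _ _ refl refl], assumption+)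
qed

end
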